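(* Let $\mathfrak g$ be of type $A_{2\ell}^{(2)}$, fix a positive integer $k$, and let $\widetilde{\mathfrak g}$ be an affine algebra of type $C_\ell^{(1)}$. If $\lambda$ is a dominant (integral) weight of $\widetilde{\mathfrak g}$ of level $k+\ell$ such that $\overline\lambda+\overline\rho$ has trivial stabilizer with respect to the affine Weyl group $\mathring W\ltimes(k+h^\vee)\nu(\mathring Q^\vee)$, $h^\vee=2\ell+1$, then there is a dominant (integral) weight $\mu$ of $\mathfrak g$ of level $k$ and a sequence of nonnegative integers $I=(i_1,\dots,i_m)$ (with each $i_j\le\ell$), where $m$ satisfies $1\le m\le k+2\ell+1$, such that $$\overline\mu+\overline\rho=w_I(\overline\lambda+\overline\rho).$$ In particular, for the homomorphism $F:V_{k+\ell}(\widetilde{\mathfrak g})\to V_k(\mathfrak g)$, $F(\chi_\lambda)=F_k(\mathring\chi_{\overline\lambda})$, and for every dominant (integral) weight $\lambda$ of $\widetilde{\mathfrak g}$ of level $k+\ell$ such that $\overline\lambda+\overline\rho$ has trivial stabilizer with respect to $\mathring W\ltimes(k+h^\vee)\nu(\mathring Q^\vee)$, with $I=(i_1,\dots,i_m)$ the corresponding sequence, $$F(\chi_\lambda)=(-1)^{i_1+\cdots+i_m}F_k(\mathring\chi_{w_I\cdot\overline\lambda}).$$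
   Context: Both $\mathfrak g$ (nodes $0,\dots,\ell$ labelled as in Kac's tables, $a_0=2$, dual Coxeter number $h^\vee=2\ell+1$) and $\widetilde{\mathfrak g}$ (dual Coxeter number $\ell+1$) have underlying simple Lie algebra $\mathring{\mathfrak g}$ of type $C_\ell$, with Weyl group $\mathring W$, sign character $\epsilon$, half-sum of positive roots $\overline\rho$, highest root $\theta=2\alpha_1+\cdots+2\alpha_{\ell-1}+\alpha_\ell$, coroot lattice $\mathring Q^\vee$; their Cartan subalgebras are identified. $(\cdot,\cdot)$ is the normalized form of $\mathfrak g$, for which $(\theta,\theta)=4$, and $\nu:\mathring{\mathfrak h}\to\mathring{\mathfrak h}^*$ the induced isomorphism; that of $\widetilde{\mathfrak g}$ has $(\theta,\theta)=2$. $\overline\lambda$ is the finite part of a weight $\lambda$. Finite parts of dominant integral weights of $\mathfrak g$ of level $k$ are the dominant integral weights $\overline\mu$ of $\mathring{\mathfrak g}$ with $(\overline\mu,\theta)\le k$. The Weyl group $W$ of $\mathfrak g$, with Coxeter generators $s_0,\dots,s_\ell$, is identified with $\mathring W\ltimes(k+h^\vee)\nu(\mathring Q^\vee)$ acting on $\mathring{\mathfrak h}^*$: $s_1,\dots,s_\ell$ are the simple reflections and $s_0(x)=s_\theta(x)+(k+h^\vee)\nu(\theta^\vee)$. Put $w_0=\mathrm{id}$, $w_i=s_{i-1}s_{i-2}\cdots s_0$ for $0<i\le\ell$, and for $I=(i_1,\dots,i_m)$, $w_I=w_{i_m}w_{i_{m-1}}\cdots w_{i_1}$. The dot action is $w\cdot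 x=w(x+\overline\rho)-\overline\rho$. For $\mathfrak u=\mathfrak g$ or $\widetilde{\mathfrak g}$, $V_m(\mathfrak u)$ is the Verlinde algebra: the complex vector space with basis the level $m$ normalized characters $\chi_\lambda$ ($\lambda$ dominant integral of level $m$ mod $\mathbb C\delta$), with structure constants $\sum_\phi S_{\lambda\phi}S_{\mu\phi}(S^{-1})_{\nu\phi}/S_{m\Lambda_0,\phi}$, where $S_{\lambda\mu}$ is proportional to $\sum_{w\in\mathring W}\epsilon(w)e^{-2\pi i(\overline\lambda+\overline\rho,w(\overline\mu+\overline\rho))/(m+h^\vee(\mathfrak u))}$ (normalized form and dual Coxeter number of $\mathfrak u$). $\mathring\chi_\lambda$ are the irreducible characters of $\mathring{\mathfrak g}$. $F_k$ is the linear map from the representation ring of $\mathring{\mathfrak g}$ (complex coefficients) to $V_k(\mathfrak g)$ sending $\mathring\chi_\lambda$ to $\epsilon(w)\chi_{k\Lambda_0+w\cdot\lambda}$ if there is $w\in\mathring W\ltimes(k+h^\vee)\nu(\mathring Q^\vee)$ with $w(\lambda+\overline\rho)$ strictly dominant and $(w(\lambda+\overline\rho),\theta)<k+h^\vee$, and to $0$ otherwise. *)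

theory Defs
  imports
    "HOL-Analysis.Analysis"
    "HOL-Algebra.Module"
    "HOL-Library.Function_Algebras"
begin

text \<open>
  The type \<open>'a\<close> plays the role of the real form of the dual of the common finite Cartan subalgebra,
  its inner product \<open>\<bullet>\<close> is the normalized form of the algebra of type \<open>A_{2l}^{(2)}\<close>, and
  \<open>\<alpha> 1, \<dots>, \<alpha> l\<close> are the simple roots of the underlying finite root system of type \<open>C_l\<close>.
\<close>

section \<open>The finite root system\<close>

text \<open>Kac's convention: the entry is \<open>\<langle>\<alpha>_i^\<or>, \<alpha>_j\<rangle> = 2 (\<alpha>_i, \<alpha>_j) / (\<alpha>_i, \<alpha>_i)\<close>, and \<open>\<alpha>_l\<close> is long.\<close>

definition cartan_C :: "nat \<Rightarrow> nat \<Rightarrow> nat \<Rightarrow> int" where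
  "cartan_C l i j =
     (if i = j then 2
      else if j = Suc i then (if j = l then - 2 else - 1)
      else if i = Suc j then - 1
      else 0)"

definition highest_root :: "nat \<Rightarrow> (nat \<Rightarrow> 'a::real_vector) \<Rightarrow> 'a" where
  "highest_root l \<alpha> = (\<Sum>i\<in>{1..<l}. 2 *\<^sub>R \<alpha> i) + \<alpha> l"

definition type_C :: "nat \<Rightarrow> (nat \<Rightarrow> 'a::euclidean_space) \<Rightarrow> bool" where
  "type_C l \<alpha> \<longleftrightarrow>
     1 \<le> l \<and> inj_on \<alpha> {1..l} \<and> independent (\<alpha> ` {1..l}) \<and> span (\<alpha> ` {1..l}) = UNIV \<and>
     (\<forall>i\<in>{1..l}. \<forall>j\<in>{1..l}. 2 * (\<alpha> i \<bullet> \<alpha> j) / (\<alpha> i \<bullet> \<alpha> i) = of_int (cartan_C l i j)) \<and>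
     highest_root l \<alpha> \<bullet> highest_root l \<alpha> = 4"

text \<open>The image \<open>\<nu>(\<beta>^\<or>)\<close> of the coroot of \<open>\<beta>\<close>; thus \<open>\<langle>x, \<beta>^\<or>\<rangle> = x \<bullet> nu_coroot \<beta>\<close>.\<close>

definition nu_coroot :: "'a::real_inner \<Rightarrow> 'a" where
  "nu_coroot \<beta> = (2 / (\<beta> \<bullet> \<beta>)) *\<^sub>R \<beta>"

definition refl_root :: "'a::real_inner \<Rightarrow> 'a \<Rightarrow> 'a" where
  "refl_root \<beta> x = x - (x \<bullet> nu_coroot \<beta>) *\<^sub>R \<beta>"

definition nu_coroot_lattice :: "nat \<Rightarrow> (nat \<Rightarrow> 'a::real_inner) \<Rightarrow> 'a set" where
  "nu_coroot_lattice l \<alpha> = {\<Sum>i\<in>{1..l}. of_int (c i) *\<^sub>R nu_coroot (\<alpha> i) | c :: nat \<Rightarrow> int. True}"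

definition word_prod :: "(nat \<Rightarrow> 'a::real_inner) \<Rightarrow> nat list \<Rightarrow> 'a \<Rightarrow> 'a" where
  "word_prod \<alpha> js = foldr (\<lambda>i f. refl_root (\<alpha> i) \<circ> f) js id"

definition weyl_group :: "nat \<Rightarrow> (nat \<Rightarrow> 'a::real_inner) \<Rightarrow> ('a \<Rightarrow> 'a) set" where
  "weyl_group l \<alpha> = {word_prod \<alpha> js | js. set js \<subseteq> {1..l}}"

definition weyl_length :: "nat \<Rightarrow> (nat \<Rightarrow> 'a::real_inner) \<Rightarrow> ('a \<Rightarrow> 'a) \<Rightarrow> nat" where
  "weyl_length l \<alpha> w = (LEAST n. \<exists>js. length js = n \<and> set js \<subseteq> {1..l} \<and> w = word_prod \<alpha> js)"

definition weyl_sign :: "nat \<Rightarrow> (nat \<Rightarrow> 'a::real_inner) \<Rightarrow> ('a \<Rightarrow> 'a) \<Rightarrow> int" where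
  "weyl_sign l \<alpha> w = (- 1) ^ weyl_length l \<alpha> w"

definition roots :: "nat \<Rightarrow> (nat \<Rightarrow> 'a::real_inner) \<Rightarrow> 'a set" where
  "roots l \<alpha> = {w (\<alpha> i) | w i. w \<in> weyl_group l \<alpha> \<and> i \<in> {1..l}}"

definition positive_roots :: "nat \<Rightarrow> (nat \<Rightarrow> 'a::real_inner) \<Rightarrow> 'a set" where
  "positive_roots l \<alpha> =
     {\<beta> \<in> roots l \<alpha>. \<exists>c :: nat \<Rightarrow> nat. \<beta> = (\<Sum>i\<in>{1..l}. of_nat (c i) *\<^sub>R \<alpha> i)}"

definition rho :: "nat \<Rightarrow> (nat \<Rightarrow> 'a::real_inner) \<Rightarrow> 'a" where
  "rho l \<alpha> = (1 / 2) *\<^sub>R (\<Sum>\<beta>\<in>positive_roots l \<alpha>. \<beta>)"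

definition dominant_integral :: "nat \<Rightarrow> (nat \<Rightarrow> 'a::real_inner) \<Rightarrow> 'a set" where
  "dominant_integral l \<alpha> = {x. \<forall>i\<in>{1..l}. x \<bullet> nu_coroot (\<alpha> i) \<in> \<nat>}"

definition strictly_dominant :: "nat \<Rightarrow> (nat \<Rightarrow> 'a::real_inner) \<Rightarrow> 'a \<Rightarrow> bool" where
  "strictly_dominant l \<alpha> x \<longleftrightarrow> (\<forall>i\<in>{1..l}. 0 < x \<bullet> nu_coroot (\<alpha> i))"

section \<open>The affine Weyl group\<close>

definition dual_coxeter_A2 :: "nat \<Rightarrow> nat" where
  "dual_coxeter_A2 l = 2 * l + 1"

definition dual_coxeter_C1 :: "nat \<Rightarrow> nat" where
  "dual_coxeter_C1 l = l + 1"

text \<open>Below, \<open>N\<close> stands for \<open>k + h^\<or>\<close> with \<open>h^\<or> = dual_coxeter_A2 l\<close>.\<close>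

definition affine_weyl_group :: "nat \<Rightarrow> (nat \<Rightarrow> 'a::real_inner) \<Rightarrow> nat \<Rightarrow> ('a \<Rightarrow> 'a) set" where
  "affine_weyl_group l \<alpha> N =
     {\<lambda>x. w x + of_nat N *\<^sub>R t | w t. w \<in> weyl_group l \<alpha> \<and> t \<in> nu_coroot_lattice l \<alpha>}"

text \<open>Translations have sign \<open>1\<close>; \<open>\<lambda>x. w x - w 0\<close> is the component of \<open>w\<close> in the finite Weyl group.\<close>

definition affine_sign :: "nat \<Rightarrow> (nat \<Rightarrow> 'a::real_inner) \<Rightarrow> ('a \<Rightarrow> 'a) \<Rightarrow> int" where
  "affine_sign l \<alpha> w = weyl_sign l \<alpha> (\<lambda>x. w x - w 0)"

definition trivial_stabilizer :: "('a \<Rightarrow> 'a) set \<Rightarrow> 'a \<Rightarrow> bool" where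
  "trivial_stabilizer W x \<longleftrightarrow> (\<forall>w\<in>W. w x = x \<longrightarrow> w = id)"

definition gen_s :: "nat \<Rightarrow> (nat \<Rightarrow> 'a::real_inner) \<Rightarrow> nat \<Rightarrow> nat \<Rightarrow> 'a \<Rightarrow> 'a" where
  "gen_s l \<alpha> N i =
     (if i = 0
      then \<lambda>x. refl_root (highest_root l \<alpha>) x + of_nat N *\<^sub>R nu_coroot (highest_root l \<alpha>)
      else refl_root (\<alpha> i))"

text \<open>\<open>w_elt l \<alpha> N i = s_{i-1} \<circ> \<dots> \<circ> s_0\<close> and \<open>w_seq l \<alpha> N [i_1, \<dots>, i_m] = w_{i_m} \<circ> \<dots> \<circ> w_{i_1}\<close>.\<close>

primrec w_elt :: "nat \<Rightarrow> (nat \<Rightarrow> 'a::real_inner) \<Rightarrow> nat \<Rightarrow> nat \<Rightarrow> 'a \<Rightarrow> 'a" where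
  "w_elt l \<alpha> N 0 = id"
| "w_elt l \<alpha> N (Suc i) = gen_s l \<alpha> N i \<circ> w_elt l \<alpha> N i"

definition w_seq :: "nat \<Rightarrow> (nat \<Rightarrow> 'a::real_inner) \<Rightarrow> nat \<Rightarrow> nat list \<Rightarrow> 'a \<Rightarrow> 'a" where
  "w_seq l \<alpha> N I = fold (\<lambda>i f. w_elt l \<alpha> N i \<circ> f) I id"

definition dot_action :: "nat \<Rightarrow> (nat \<Rightarrow> 'a::real_inner) \<Rightarrow> ('a \<Rightarrow> 'a) \<Rightarrow> 'a \<Rightarrow> 'a" where
  "dot_action l \<alpha> w x = w (x + rho l \<alpha>) - rho l \<alpha>"

section \<open>Dominant weights of given level and Verlinde algebras\<close>

text \<open>
  A weight of fixed level modulo \<open>\<complex>\<delta>\<close> is represented by its finite part.  The two affine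
  algebras enter through their normalized forms (\<open>form\<close>) and dual Coxeter numbers (\<open>h\<close>).
\<close>

definition form_A2 :: "'a::real_inner \<Rightarrow> 'a \<Rightarrow> real" where
  "form_A2 x y = x \<bullet> y"

text \<open>The multiple of \<open>\<bullet>\<close> that takes the value \<open>2\<close> on the highest root.\<close>

definition form_C1 :: "'a::real_inner \<Rightarrow> 'a \<Rightarrow> real" where
  "form_C1 x y = (x \<bullet> y) / 2"

definition level_weights ::
    "nat \<Rightarrow> (nat \<Rightarrow> 'a::real_inner) \<Rightarrow> ('a \<Rightarrow> 'a \<Rightarrow> real) \<Rightarrow> nat \<Rightarrow> 'a set" where
  "level_weights l \<alpha> form m = {x \<in> dominant_integral l \<alpha>. form x (highest_root l \<alpha>) \<le> of_nat m}"

text \<open>The structure constants do not change when \<open>S\<close> is multiplied by a nonzero constant.\<close>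

definition S_matrix ::
    "nat \<Rightarrow> (nat \<Rightarrow> 'a::real_inner) \<Rightarrow> ('a \<Rightarrow> 'a \<Rightarrow> real) \<Rightarrow> nat \<Rightarrow> nat \<Rightarrow> 'a \<Rightarrow> 'a \<Rightarrow> complex" where
  "S_matrix l \<alpha> form h m x y =
     (\<Sum>w\<in>weyl_group l \<alpha>. of_int (weyl_sign l \<alpha> w) *
        exp (- (2 * of_real pi * \<i> * of_real (form (x + rho l \<alpha>) (w (y + rho l \<alpha>)))) / of_nat (m + h)))"

definition inverse_matrix_on :: "'b set \<Rightarrow> ('b \<Rightarrow> 'b \<Rightarrow> complex) \<Rightarrow> 'b \<Rightarrow> 'b \<Rightarrow> complex" where
  "inverse_matrix_on P S = (THE T.
     (\<forall>x\<in>P. \<forall>y\<in>P. (\<Sum>z\<in>P. S x z * T z y) = (if x = y then 1 else 0)) \<and>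
     (\<forall>x\<in>P. \<forall>y\<in>P. (\<Sum>z\<in>P. T x z * S z y) = (if x = y then 1 else 0)) \<and>
     (\<forall>x y. x \<notin> P \<or> y \<notin> P \<longrightarrow> T x y = 0))"

definition fusion_coeff ::
    "nat \<Rightarrow> (nat \<Rightarrow> 'a::real_inner) \<Rightarrow> ('a \<Rightarrow> 'a \<Rightarrow> real) \<Rightarrow> nat \<Rightarrow> nat \<Rightarrow> 'a \<Rightarrow> 'a \<Rightarrow> 'a \<Rightarrow> complex" where
  "fusion_coeff l \<alpha> form h m x y z =
     (let P = level_weights l \<alpha> form m; S = S_matrix l \<alpha> form h m in
      \<Sum>\<phi>\<in>P. S x \<phi> * S y \<phi> * inverse_matrix_on P S z \<phi> / S 0 \<phi>)"

definition cscale :: "complex \<Rightarrow> ('b \<Rightarrow> complex) \<Rightarrow> 'b \<Rightarrow> complex" where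
  "cscale c f = (\<lambda>x. c * f x)"

text \<open>The normalized affine character indexed by \<open>x\<close>, as a basis vector of the Verlinde algebra.\<close>

definition chi :: "'a \<Rightarrow> 'a \<Rightarrow> complex" where
  "chi x = (\<lambda>y. if y = x then 1 else 0)"

definition verlinde ::
    "nat \<Rightarrow> (nat \<Rightarrow> 'a::real_inner) \<Rightarrow> ('a \<Rightarrow> 'a \<Rightarrow> real) \<Rightarrow> nat \<Rightarrow> nat \<Rightarrow> (complex, 'a \<Rightarrow> complex) module" where
  "verlinde l \<alpha> form h m =
     (let P = level_weights l \<alpha> form m in
      \<lparr>carrier = {f. \<forall>x. x \<notin> P \<longrightarrow> f x = 0},
       monoid.mult = (\<lambda>f g. \<Sum>x\<in>P. \<Sum>y\<in>P. \<Sum>z\<in>P.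
          cscale (f x * g y * fusion_coeff l \<alpha> form h m x y z) (chi z)),
       one = chi 0,
       zero = 0,
       add = (\<lambda>f g. f + g),
       smult = cscale\<rparr>)"

definition verlinde_A2 :: "nat \<Rightarrow> (nat \<Rightarrow> 'a::real_inner) \<Rightarrow> nat \<Rightarrow> (complex, 'a \<Rightarrow> complex) module" where
  "verlinde_A2 l \<alpha> m = verlinde l \<alpha> form_A2 (dual_coxeter_A2 l) m"

definition verlinde_C1 :: "nat \<Rightarrow> (nat \<Rightarrow> 'a::real_inner) \<Rightarrow> nat \<Rightarrow> (complex, 'a \<Rightarrow> complex) module" where
  "verlinde_C1 l \<alpha> m = verlinde l \<alpha> form_C1 (dual_coxeter_C1 l) m"

definition complex_alg_hom ::
    "(complex, 'b, 'm) module_scheme \<Rightarrow> (complex, 'c, 'n) module_scheme \<Rightarrow> ('b \<Rightarrow> 'c) set" where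
  "complex_alg_hom A B =
     {F \<in> ring_hom A B. \<forall>c. \<forall>x\<in>carrier A. F (c \<odot>\<^bsub>A\<^esub> x) = c \<odot>\<^bsub>B\<^esub> F x}"

section \<open>Irreducible characters of the finite-dimensional simple Lie algebra\<close>

text \<open>
  By Serre's theorem, a module over the simple Lie algebra of type \<open>C_l\<close> is a vector space with
  operators \<open>e i, f i, h i\<close> satisfying the Chevalley--Serre relations.  Every finite-dimensional
  complex vector space is isomorphic to a subspace \<open>V\<close> of \<open>nat \<Rightarrow> complex\<close>; the operators
  matter only on \<open>V\<close>.
\<close>

type_synonym cvec = "nat \<Rightarrow> complex"
type_synonym cop = "cvec \<Rightarrow> cvec"

definition endo_on :: "cvec set \<Rightarrow> cop \<Rightarrow> bool" where
  "endo_on V A \<longleftrightarrow>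
     (\<forall>v\<in>V. A v \<in> V) \<and> (\<forall>u\<in>V. \<forall>v\<in>V. A (u + v) = A u + A v) \<and>
     (\<forall>c. \<forall>v\<in>V. A (cscale c v) = cscale c (A v))"

definition commutator :: "cop \<Rightarrow> cop \<Rightarrow> cop" where
  "commutator A B = (\<lambda>v. A (B v) - B (A v))"

definition C_module :: "nat \<Rightarrow> cvec set \<Rightarrow> (nat \<Rightarrow> cop) \<Rightarrow> (nat \<Rightarrow> cop) \<Rightarrow> (nat \<Rightarrow> cop) \<Rightarrow> bool" where
  "C_module l V e f h \<longleftrightarrow>
     (\<exists>B. finite B \<and> V = module.span cscale B) \<and>
     (\<forall>i\<in>{1..l}. endo_on V (e i) \<and> endo_on V (f i) \<and> endo_on V (h i)) \<and>
     (\<forall>i\<in>{1..l}. \<forall>j\<in>{1..l}. \<forall>v\<in>V.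
        commutator (h i) (h j) v = 0 \<and>
        commutator (e i) (f j) v = (if i = j then h i v else 0) \<and>
        commutator (h i) (e j) v = cscale (of_int (cartan_C l i j)) (e j v) \<and>
        commutator (h i) (f j) v = cscale (- of_int (cartan_C l i j)) (f j v) \<and>
        (i \<noteq> j \<longrightarrow>
          (commutator (e i) ^^ nat (1 - cartan_C l i j)) (e j) v = 0 \<and>
          (commutator (f i) ^^ nat (1 - cartan_C l i j)) (f j) v = 0))"

definition irreducible_C_module ::
    "nat \<Rightarrow> cvec set \<Rightarrow> (nat \<Rightarrow> cop) \<Rightarrow> (nat \<Rightarrow> cop) \<Rightarrow> (nat \<Rightarrow> cop) \<Rightarrow> bool" where
  "irreducible_C_module l V e f h \<longleftrightarrow>
     C_module l V e f h \<and> V \<noteq> {0} \<and>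
     (\<forall>U. module.subspace cscale U \<and> U \<subseteq> V \<and>
          (\<forall>i\<in>{1..l}. \<forall>v\<in>U. e i v \<in> U \<and> f i v \<in> U \<and> h i v \<in> U) \<longrightarrow> U = {0} \<or> U = V)"

definition weight_space ::
    "nat \<Rightarrow> (nat \<Rightarrow> 'a::real_inner) \<Rightarrow> cvec set \<Rightarrow> (nat \<Rightarrow> cop) \<Rightarrow> 'a \<Rightarrow> cvec set" where
  "weight_space l \<alpha> V h x =
     {v \<in> V. \<forall>i\<in>{1..l}. h i v = cscale (of_real (x \<bullet> nu_coroot (\<alpha> i))) v}"

text \<open>Characters are the formal sums \<open>\<Sum>x. dim (V_x) e^x\<close>, written as functions of the weight \<open>x\<close>.\<close>

definition formal_character ::
    "nat \<Rightarrow> (nat \<Rightarrow> 'a::real_inner) \<Rightarrow> cvec set \<Rightarrow> (nat \<Rightarrow> cop) \<Rightarrow> 'a \<Rightarrow> complex" where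
  "formal_character l \<alpha> V h = (\<lambda>x. of_nat (vector_space.dim cscale (weight_space l \<alpha> V h x)))"

definition has_highest_weight ::
    "nat \<Rightarrow> (nat \<Rightarrow> 'a::real_inner) \<Rightarrow> cvec set \<Rightarrow> (nat \<Rightarrow> cop) \<Rightarrow> (nat \<Rightarrow> cop) \<Rightarrow> 'a \<Rightarrow> bool" where
  "has_highest_weight l \<alpha> V e h x \<longleftrightarrow>
     (\<exists>v\<in>weight_space l \<alpha> V h x. v \<noteq> 0 \<and> (\<forall>i\<in>{1..l}. e i v = 0))"

definition irr_char :: "nat \<Rightarrow> (nat \<Rightarrow> 'a::real_inner) \<Rightarrow> 'a \<Rightarrow> 'a \<Rightarrow> complex" where
  "irr_char l \<alpha> x = (THE c. \<exists>V e f h.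
     irreducible_C_module l V e f h \<and> has_highest_weight l \<alpha> V e h x \<and>
     c = formal_character l \<alpha> V h)"

definition rep_ring :: "nat \<Rightarrow> (nat \<Rightarrow> 'a::real_inner) \<Rightarrow> ('a \<Rightarrow> complex) set" where
  "rep_ring l \<alpha> = module.span cscale (irr_char l \<alpha> ` dominant_integral l \<alpha>)"

section \<open>The map \<open>F_k\<close>\<close>

definition alcove_elt :: "nat \<Rightarrow> (nat \<Rightarrow> 'a::real_inner) \<Rightarrow> nat \<Rightarrow> 'a \<Rightarrow> ('a \<Rightarrow> 'a) \<Rightarrow> bool" where
  "alcove_elt l \<alpha> N x w \<longleftrightarrow>
     w \<in> affine_weyl_group l \<alpha> N \<and> strictly_dominant l \<alpha> (w x) \<and>
     form_A2 (w x) (highest_root l \<alpha>) < of_nat N"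

text \<open>The element \<open>w\<close> selected below is unique, the inequalities describing an open alcove.\<close>

definition Fk_value :: "nat \<Rightarrow> (nat \<Rightarrow> 'a::real_inner) \<Rightarrow> nat \<Rightarrow> 'a \<Rightarrow> 'a \<Rightarrow> complex" where
  "Fk_value l \<alpha> k x =
     (let N = k + dual_coxeter_A2 l in
      if \<exists>w. alcove_elt l \<alpha> N (x + rho l \<alpha>) w
      then let w = (SOME w. alcove_elt l \<alpha> N (x + rho l \<alpha>) w)
           in cscale (of_int (affine_sign l \<alpha> w)) (chi (dot_action l \<alpha> w x))
      else 0)"

text \<open>
  The conditions determine a unique linear map on \<open>rep_ring l \<alpha>\<close>, since the irreducible
  characters form a basis of it.
\<close>

definition is_Fk ::
    "nat \<Rightarrow> (nat \<Rightarrow> 'a::real_inner) \<Rightarrow> nat \<Rightarrow> (('a \<Rightarrow> complex) \<Rightarrow> 'a \<Rightarrow> complex) \<Rightarrow> bool" where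
  "is_Fk l \<alpha> k Fk \<longleftrightarrow>
     (\<forall>p\<in>rep_ring l \<alpha>. \<forall>q\<in>rep_ring l \<alpha>. Fk (p + q) = Fk p + Fk q) \<and>
     (\<forall>c. \<forall>p\<in>rep_ring l \<alpha>. Fk (cscale c p) = cscale c (Fk p)) \<and>
     (\<forall>x\<in>dominant_integral l \<alpha>. Fk (irr_char l \<alpha> x) = Fk_value l \<alpha> k x)"

section \<open>Sequences carrying a weight into the alcove\<close>

definition alcove_seq :: "nat \<Rightarrow> (nat \<Rightarrow> 'a::real_inner) \<Rightarrow> nat \<Rightarrow> 'a \<Rightarrow> 'a \<Rightarrow> nat list \<Rightarrow> bool" where
  "alcove_seq l \<alpha> k x \<mu> I \<longleftrightarrow>
     \<mu> \<in> level_weights l \<alpha> form_A2 k \<and>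
     (\<forall>i\<in>set I. i \<le> l) \<and> 1 \<le> length I \<and> length I \<le> k + 2 * l + 1 \<and>
     \<mu> + rho l \<alpha> = w_seq l \<alpha> (k + dual_coxeter_A2 l) I (x + rho l \<alpha>)"

end

theory Submission
  imports Defs
begin

text \<open>
  In an orthonormal basis with \<open>\<alpha>_i = e_i - e_{i+1}\<close> and \<open>\<alpha>_l = 2 e_l\<close>, the finite Weyl group acts by
  signed permutations and the coroot lattice becomes \<open>\<int>^l\<close>.  With \<open>N = k + 2l + 1\<close>, both families of
  level weights, shifted by \<open>\<rho>\<close>, are the integral points with \<open>p_1 > \<dots> > p_l > 0\<close> and \<open>2 p_1 < M\<close>,
  where \<open>M = N\<close> for \<open>A_{2l}^{(2)}\<close> and \<open>M = 2N\<close> for \<open>C_l^{(1)}\<close>, and both S-matrices are the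
  same kernel \<open>K_M(p, q) = \<Sum>_w \<epsilon>(w) exp (- 2 \<pi> \<i> (p, w q) / M)\<close>.

  For the first part, \<open>w_i\<close> replaces \<open>p_1\<close> by \<open>N - p_1\<close> and puts it in position \<open>i\<close>; each such step, with
  \<open>i\<close> chosen so that the result is sorted, removes one coordinate larger than \<open>N / 2\<close>.

  For the second part, \<open>K_M\<close> is antisymmetric under the affine Weyl group, so \<open>F_k\<close> is compatible with
  \<open>x \<mapsto> K_N(x, \<phi>)\<close>; and \<open>K_N(x, \<phi>) = K_{2N}(x, 2 \<phi>)\<close>, where doubling maps the small alcove into the
  large one.  Hence the characters of the Verlinde algebra of \<open>A_{2l}^{(2)}\<close> pull back to characters of
  that of \<open>C_l^{(1)}\<close>, and they separate points because \<open>K_N\<close> is invertible.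
\<close>

section \<open>Coordinates and the finite Weyl group\<close>

text \<open>The modulus \<open>2 N\<close> arises because level plus dual Coxeter number on the
  \<open>C\<close> side is \<open>(k + l) + (l + 1) = N\<close> while the form there is half of
  \<open>\<bullet>\<close>. Since \<open>F\<close> is defined on basis vectors by the values of
  \<open>F_k\<close>, agreement with \<open>F_k\<close> is immediate and the real work is
  multiplicativity. The obstacle is that an integral orbit may miss the open alcove:
  \<open>F_k\<close> is then 0, and the kernel has to vanish too. Both are settled by one dichotomy:
  either the orbit meets the alcove, or the point is fixed by an element of sign -1. The same
  dichotomy gives the invertibility of \<open>K_M\<close>, by bringing the orthogonality of
  exponentials on (Z/M)^l down to the alcove. Signs are defined by shortest words, so they are first
  identified with determinants of signed permutations. In the first part at most \<open>l\<close>
  coordinates exceed \<open>N / 2\<close>; one extra entry 0, with \<open>w_0 = id\<close>, keeps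
  the sequence nonempty.\<close>

locale C_roots =
  fixes l :: nat and \<alpha> :: "nat \<Rightarrow> 'a::euclidean_space"
  assumes type_C: "type_C l \<alpha>"
begin

lemma l_pos: "1 \<le> l"
  using type_C by (simp add: type_C_def)

lemma cartan:
  "i \<in> {1..l} \<Longrightarrow> j \<in> {1..l} \<Longrightarrow> 2 * (\<alpha> i \<bullet> \<alpha> j) / (\<alpha> i \<bullet> \<alpha> i) = of_int (cartan_C l i j)"
  using type_C by (simp add: type_C_def)

lemma alpha_norm_nonzero: "i \<in> {1..l} \<Longrightarrow> \<alpha> i \<bullet> \<alpha> i \<noteq> 0"
  using cartan[of i i] by (auto simp: cartan_C_def)

lemma alpha_inner:
  "i \<in> {1..l} \<Longrightarrow> j \<in> {1..l} \<Longrightarrow> 2 * (\<alpha> i \<bullet> \<alpha> j) = of_int (cartan_C l i j) * (\<alpha> i \<bullet> \<alpha> i)"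
  using cartan[of i j] alpha_norm_nonzero[of i] by (simp add: field_simps)

text \<open>Comparing the two Cartan entries of neighbouring nodes gives equal lengths, except at
  the last edge, where the entries -2 and -1 make the squared length half that of
  \<open>\<alpha> l\<close>. The downward induction starts at that edge.\<close>

lemma alpha_norm:
  assumes "1 \<le> i" "i < l"
  shows "\<alpha> i \<bullet> \<alpha> i = (\<alpha> l \<bullet> \<alpha> l) / 2"
  using assms(2,1)
proof (induction rule: strict_inc_induct)
  case (base i)
  then show ?case
    using alpha_inner[of i "Suc i"] alpha_inner[of "Suc i" i]
    by (auto simp: cartan_C_def inner_commute)
next
  case (step i)
  then show ?case
    using alpha_inner[of i "Suc i"] alpha_inner[of "Suc i" i]
    by (auto simp: cartan_C_def inner_commute)
qed

text \<open>The orthonormal basis in which \<open>\<alpha> i = e i - e (i + 1)\<close> for \<open>i < l\<close> and \<open>\<alpha> l = 2 e l\<close>.\<close>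

definition e :: "nat \<Rightarrow> 'a" where
  "e i = (\<Sum>j\<in>{i..<l}. \<alpha> j) + (1/2) *\<^sub>R \<alpha> l"

lemma e_last: "e l = (1/2) *\<^sub>R \<alpha> l"
  by (simp add: e_def)

lemma e_step: "i < l \<Longrightarrow> e i = \<alpha> i + e (Suc i)"
  by (simp add: e_def sum.atLeast_Suc_lessThan)

text \<open>Lengths are known so far only up to a common scale, kept here as the factor
  \<open>(\<alpha> l \<bullet> \<alpha> l) / 4\<close>. It becomes 1 in
  \<open>alpha_last_norm\<close>, once the highest root is recognized as
  \<open>2 e 1\<close>.\<close>

lemma e_inner_alpha_scaled:
  assumes "1 \<le> i" "i \<le> l" "1 \<le> j" "j \<le> l"
  shows "e i \<bullet> \<alpha> j = (\<alpha> l \<bullet> \<alpha> l) / 4 *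
    (if j = l then (if i = l then 2 else 0) else if j = i then 1 else if i = Suc j then - 1 else 0)"
  using assms(2,1)
proof (induction rule: inc_induct)
  case base
  then show ?case
    using alpha_inner[of l j] assms by (auto simp: e_last cartan_C_def)
next
  case (step i)
  have IH: "e (Suc i) \<bullet> \<alpha> j = (\<alpha> l \<bullet> \<alpha> l) / 4 *
    (if j = l then (if Suc i = l then 2 else 0) else if j = Suc i then 1 else if Suc i = Suc j then - 1 else 0)"
    using step by simp
  have "\<alpha> i \<bullet> \<alpha> i = (\<alpha> l \<bullet> \<alpha> l) / 2"
    using alpha_norm[of i] step by simp
  moreover have "2 * (\<alpha> i \<bullet> \<alpha> j) = of_int (cartan_C l i j) * (\<alpha> i \<bullet> \<alpha> i)"
    using alpha_inner[of i j] step assms by simp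
  ultimately have "2 * (\<alpha> i \<bullet> \<alpha> j) = of_int (cartan_C l i j) * ((\<alpha> l \<bullet> \<alpha> l) / 2)"
    by metis
  then have "\<alpha> i \<bullet> \<alpha> j = of_int (cartan_C l i j) * (\<alpha> l \<bullet> \<alpha> l) / 4"
    by simp
  then show ?case
    unfolding e_step[OF step(2)] inner_add_left IH
    using step assms by (auto simp: cartan_C_def)
qed

lemma e_orthogonal_scaled:
  assumes "1 \<le> i" "i \<le> l" "1 \<le> j" "j \<le> l"
  shows "e i \<bullet> e j = (\<alpha> l \<bullet> \<alpha> l) / 4 * (if i = j then 1 else 0)"
  using assms(4,3)
proof (induction rule: inc_induct)
  case base
  then show ?case
    using e_inner_alpha_scaled[of i l] assms(1,2) by (auto simp: e_last[THEN arg_cong, of "inner (e i)"])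
next
  case (step j)
  have "e i \<bullet> e j = e i \<bullet> \<alpha> j + e i \<bullet> e (Suc j)"
    by (simp add: e_step step inner_add_right)
  with step e_inner_alpha_scaled[of i j] assms(1,2) show ?case by auto
qed

lemma highest_root_eq: "highest_root l \<alpha> = 2 *\<^sub>R e 1"
  by (simp add: highest_root_def e_def scaleR_add_right scaleR_sum_right)

lemma alpha_last_norm: "\<alpha> l \<bullet> \<alpha> l = 4"
proof -
  have "highest_root l \<alpha> \<bullet> highest_root l \<alpha> = 4"
    using type_C by (simp add: type_C_def)
  then show ?thesis
    using e_orthogonal_scaled[of 1 1] l_pos by (simp add: highest_root_eq)
qed

lemma e_inner: "i \<in> {1..l} \<Longrightarrow> j \<in> {1..l} \<Longrightarrow> e i \<bullet> e j = (if i = j then 1 else 0)"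
  using e_orthogonal_scaled[of i j] by (simp add: alpha_last_norm)

lemma alpha_short: "i < l \<Longrightarrow> \<alpha> i = e i - e (Suc i)"
  by (simp add: e_step)

lemma alpha_long: "\<alpha> l = 2 *\<^sub>R e l"
  by (simp add: e_last)

lemma nu_coroot_short: "1 \<le> i \<Longrightarrow> i < l \<Longrightarrow> nu_coroot (\<alpha> i) = e i - e (Suc i)"
  by (simp add: nu_coroot_def alpha_norm alpha_last_norm e_step)

lemma nu_coroot_long: "nu_coroot (\<alpha> l) = e l"
  by (simp add: nu_coroot_def alpha_last_norm e_last)

lemma nu_coroot_highest: "nu_coroot (highest_root l \<alpha>) = e 1"
  using l_pos by (simp add: nu_coroot_def highest_root_eq e_inner)

text \<open>The simple roots are combinations of the \<open>e i\<close> and span the space, so a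
  difference with zero coordinates is orthogonal to everything, itself included.\<close>

lemma coord_eqI:
  assumes "\<And>i. i \<in> {1..l} \<Longrightarrow> x \<bullet> e i = y \<bullet> e i"
  shows "x = y"
proof -
  have 1: "(x - y) \<bullet> \<alpha> i = 0" if "i \<in> {1..l}" for i
  proof (cases "i = l")
    case True
    then show ?thesis using assms[of l] l_pos by (simp add: alpha_long inner_diff_left)
  next
    case False
    then show ?thesis using that assms[of i] assms[of "Suc i"]
      by (simp add: alpha_short inner_diff_left inner_diff_right)
  qed
  have "x - y \<in> span (\<alpha> ` {1..l})" using type_C by (simp add: type_C_def)
  then have "orthogonal (x - y) (x - y)"
    by (rule orthogonal_to_span) (use 1 in \<open>auto simp: orthogonal_def\<close>)
  then show ?thesis by (simp add: orthogonal_def)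
qed

lemma coord_sum: "i \<in> {1..l} \<Longrightarrow> (\<Sum>j\<in>{1..l}. c j *\<^sub>R e j) \<bullet> e i = c i"
  by (simp add: inner_sum_left e_inner if_distrib sum.delta cong: if_cong)

lemma coord_expand: "x = (\<Sum>j\<in>{1..l}. (x \<bullet> e j) *\<^sub>R e j)"
  by (rule coord_eqI) (simp only: coord_sum)

lemma inner_coord: "x \<bullet> y = (\<Sum>j\<in>{1..l}. (x \<bullet> e j) * (y \<bullet> e j))"
  by (subst coord_expand[of y]) (simp add: inner_sum_right mult.commute)

lemma inner_highest: "x \<bullet> highest_root l \<alpha> = 2 * (x \<bullet> e 1)"
  by (simp add: highest_root_eq)

lemma refl_short_coord:
  assumes "1 \<le> i" "i < l" "j \<in> {1..l}"
  shows "refl_root (\<alpha> i) x \<bullet> e j = x \<bullet> e (Transposition.transpose i (Suc i) j)"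
proof -
  have "refl_root (\<alpha> i) x = x - (x \<bullet> e i - x \<bullet> e (Suc i)) *\<^sub>R (e i - e (Suc i))"
    using assms by (simp add: refl_root_def nu_coroot_short inner_diff_right) (simp add: alpha_short)
  then show ?thesis
    using assms by (auto simp: inner_diff_left e_inner Transposition.transpose_def)
qed

lemma refl_double_coord:
  assumes "i \<in> {1..l}" "j \<in> {1..l}"
  shows "refl_root (2 *\<^sub>R e i) x \<bullet> e j = (if j = i then - (x \<bullet> e j) else x \<bullet> e j)"
  using assms by (auto simp: refl_root_def nu_coroot_def inner_diff_left e_inner)

section \<open>Signed permutations and the sign character\<close>

definition signed_perm :: "('a \<Rightarrow> 'a) \<Rightarrow> (nat \<Rightarrow> nat) \<Rightarrow> (nat \<Rightarrow> int) \<Rightarrow> bool" where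
  "signed_perm w p s \<longleftrightarrow> p permutes {1..l} \<and> (\<forall>i\<in>{1..l}. s i = 1 \<or> s i = - 1) \<and>
     (\<forall>x. \<forall>i\<in>{1..l}. w x \<bullet> e i = of_int (s i) * (x \<bullet> e (p i)))"

lemma signed_permD:
  assumes "signed_perm w p s"
  shows "p permutes {1..l}" "i \<in> {1..l} \<Longrightarrow> s i = 1 \<or> s i = - 1"
    "i \<in> {1..l} \<Longrightarrow> w x \<bullet> e i = of_int (s i) * (x \<bullet> e (p i))"
    "i \<in> {1..l} \<Longrightarrow> p i \<in> {1..l}"
  using assms permutes_in_image[of p "{1..l}" i] by (auto simp: signed_perm_def)

lemma signed_perm_id: "signed_perm id id (\<lambda>_. 1)"
  by (simp add: signed_perm_def permutes_id)

lemma signed_perm_short: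
  "1 \<le> i \<Longrightarrow> i < l \<Longrightarrow> signed_perm (refl_root (\<alpha> i)) (Transposition.transpose i (Suc i)) (\<lambda>_. 1)"
  by (simp add: signed_perm_def permutes_swap_id refl_short_coord)

lemma signed_perm_double:
  "i \<in> {1..l} \<Longrightarrow> signed_perm (refl_root (2 *\<^sub>R e i)) id (\<lambda>j. if j = i then - 1 else 1)"
  by (simp add: signed_perm_def permutes_id refl_double_coord)

text \<open>Coordinates are pulled back along the permutation, so permutations compose in the
  reverse order.\<close>

lemma signed_perm_comp:
  assumes "signed_perm v p s" "signed_perm w q t"
  shows "signed_perm (v \<circ> w) (q \<circ> p) (\<lambda>i. s i * t (p i))"
  unfolding signed_perm_def
proof (intro conjI allI ballI)
  show "(q \<circ> p) permutes {1..l}" using assms permutes_compose signed_permD(1) by blast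
  fix i assume i: "i \<in> {1..l}"
  note pi = signed_permD(4)[OF assms(1) i]
  show "s i * t (p i) = 1 \<or> s i * t (p i) = - 1"
    using signed_permD(2)[OF assms(1) i] signed_permD(2)[OF assms(2) pi] by auto
  show "(v \<circ> w) x \<bullet> e i = of_int (s i * t (p i)) * (x \<bullet> e ((q \<circ> p) i))" for x
    using signed_permD(3)[OF assms(1) i] signed_permD(3)[OF assms(2) pi] by simp
qed

text \<open>The determinant of the signed permutation matrix. Its multiplicativity is direct, while
  that of \<open>weyl_sign\<close>, defined through shortest words, is not.\<close>

definition perm_sign :: "(nat \<Rightarrow> nat) \<Rightarrow> (nat \<Rightarrow> int) \<Rightarrow> int" where
  "perm_sign p s = sign p * (\<Prod>i\<in>{1..l}. s i)"

lemma permutes_permutation: "p permutes {1..l} \<Longrightarrow> permutation p"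
  using permutation_permutes by blast

lemma perm_sign_comp:
  assumes "signed_perm v p s" "signed_perm w q t"
  shows "perm_sign (q \<circ> p) (\<lambda>i. s i * t (p i)) = perm_sign p s * perm_sign q t"
proof -
  have p: "p permutes {1..l}" and q: "q permutes {1..l}" using assms signed_permD(1) by blast+
  have "(\<Prod>i\<in>{1..l}. t (p i)) = (\<Prod>i\<in>{1..l}. t i)"
    using prod.permute[OF p, of t] by (simp add: comp_def)
  then show ?thesis
    using sign_compose[OF permutes_permutation[OF q] permutes_permutation[OF p]]
    by (simp add: perm_sign_def prod.distrib)
qed

text \<open>Testing at \<open>x = e (p i)\<close> gives the nonzero value \<open>s i\<close>, so the
  other description must select the same coordinate with the same sign.\<close>

lemma signed_perm_unique:
  assumes "signed_perm w p s" "signed_perm w q t"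
  shows "p = q" "\<forall>i\<in>{1..l}. s i = t i"
proof -
  have *: "p i = q i \<and> s i = t i" if i: "i \<in> {1..l}" for i
  proof -
    have "of_int (s i) * (e (p i) \<bullet> e (p i)) = (of_int (t i) * (e (p i) \<bullet> e (q i)) :: real)"
      using signed_permD(3)[OF assms(1) i, of "e (p i)"] signed_permD(3)[OF assms(2) i, of "e (p i)"] by simp
    then show ?thesis
      using signed_permD(2,4)[OF assms(1) i] signed_permD(2,4)[OF assms(2) i]
      by (auto simp: e_inner split: if_splits)
  qed
  then show "\<forall>i\<in>{1..l}. s i = t i" by blast
  show "p = q"
  proof
    show "p i = q i" for i
      using * signed_permD(1)[OF assms(1)] signed_permD(1)[OF assms(2)]
      by (cases "i \<in> {1..l}") (auto simp: permutes_def)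
  qed
qed

lemma perm_sign_unique:
  "signed_perm w p s \<Longrightarrow> signed_perm w q t \<Longrightarrow> perm_sign p s = perm_sign q t"
  using signed_perm_unique[of w p s q t] by (simp add: perm_sign_def)

lemma signed_perm_alpha:
  assumes "i \<in> {1..l}"
  shows "\<exists>p s. signed_perm (refl_root (\<alpha> i)) p s \<and> perm_sign p s = - 1"
proof (cases "i = l")
  case True
  then show ?thesis using signed_perm_double[of l] l_pos
    by (intro exI conjI) (auto simp: alpha_long perm_sign_def)
next
  case False
  then show ?thesis using signed_perm_short[of i] assms
    by (intro exI conjI) (auto simp: perm_sign_def sign_swap_id)
qed

lemma word_prod_Nil: "word_prod \<alpha> [] = id"
  by (simp add: word_prod_def)

lemma word_prod_Cons: "word_prod \<alpha> (i # js) = refl_root (\<alpha> i) \<circ> word_prod \<alpha> js"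
  by (simp add: word_prod_def)

lemma word_prod_append: "word_prod \<alpha> (is @ js) = word_prod \<alpha> is \<circ> word_prod \<alpha> js"
  by (induction "is") (simp_all add: word_prod_Nil word_prod_Cons comp_assoc)

lemma signed_perm_word:
  "set js \<subseteq> {1..l} \<Longrightarrow> \<exists>p s. signed_perm (word_prod \<alpha> js) p s \<and> perm_sign p s = (- 1) ^ length js"
proof (induction js)
  case Nil
  show ?case unfolding word_prod_Nil
    by (intro exI[of _ id] exI[of _ "\<lambda>_. 1"] conjI signed_perm_id) (simp add: perm_sign_def)
next
  case (Cons i js)
  then obtain p s where ps: "signed_perm (word_prod \<alpha> js) p s" "perm_sign p s = (- 1) ^ length js"
    by auto
  obtain q t where qt: "signed_perm (refl_root (\<alpha> i)) q t" "perm_sign q t = - 1"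
    using signed_perm_alpha[of i] Cons.prems by auto
  show ?case
    unfolding word_prod_Cons
    by (intro exI conjI, rule signed_perm_comp[OF qt(1) ps(1)])
      (simp only: perm_sign_comp[OF qt(1) ps(1)] ps(2) qt(2) list.size power_Suc, simp)
qed

text \<open>All words for one map have the same parity, since each parity is the determinant of that
  map; this frees the sign from the shortest word.\<close>

lemma weyl_sign_word: "set js \<subseteq> {1..l} \<Longrightarrow> weyl_sign l \<alpha> (word_prod \<alpha> js) = (- 1) ^ length js"
proof -
  assume js: "set js \<subseteq> {1..l}"
  let ?P = "\<lambda>n. \<exists>js'. length js' = n \<and> set js' \<subseteq> {1..l} \<and> word_prod \<alpha> js = word_prod \<alpha> js'"
  have "?P (LEAST n. ?P n)" by (rule LeastI[of ?P "length js"]) (use js in blast)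
  then obtain js' where js': "length js' = weyl_length l \<alpha> (word_prod \<alpha> js)" "set js' \<subseteq> {1..l}"
    "word_prod \<alpha> js = word_prod \<alpha> js'"
    unfolding weyl_length_def by auto
  show ?thesis
    using signed_perm_word[OF js] signed_perm_word[OF js'(2)] perm_sign_unique js'
    unfolding weyl_sign_def by metis
qed

lemma weyl_signed_perm:
  "w \<in> weyl_group l \<alpha> \<Longrightarrow> \<exists>p s. signed_perm w p s \<and> perm_sign p s = weyl_sign l \<alpha> w"
  using signed_perm_word weyl_sign_word unfolding weyl_group_def by fastforce

lemma weyl_sign_eq: "w \<in> weyl_group l \<alpha> \<Longrightarrow> signed_perm w p s \<Longrightarrow> weyl_sign l \<alpha> w = perm_sign p s"
  using weyl_signed_perm perm_sign_unique by metis

lemma id_weyl: "id \<in> weyl_group l \<alpha>"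
  unfolding weyl_group_def by (auto intro!: exI[of _ "[]"] simp: word_prod_Nil)

lemma comp_weyl: "v \<in> weyl_group l \<alpha> \<Longrightarrow> w \<in> weyl_group l \<alpha> \<Longrightarrow> v \<circ> w \<in> weyl_group l \<alpha>"
  unfolding weyl_group_def
proof clarify
  fix js ks assume "set js \<subseteq> {1..l}" "set ks \<subseteq> {1..l}"
  then show "\<exists>is. word_prod \<alpha> js \<circ> word_prod \<alpha> ks = word_prod \<alpha> is \<and> set is \<subseteq> {1..l}"
    by (intro exI[of _ "js @ ks"]) (simp add: word_prod_append)
qed

lemma refl_weyl: "i \<in> {1..l} \<Longrightarrow> refl_root (\<alpha> i) \<in> weyl_group l \<alpha>"
  unfolding weyl_group_def by (auto intro!: exI[of _ "[i]"] simp: word_prod_Nil word_prod_Cons)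

lemma weyl_sign_comp:
  assumes "v \<in> weyl_group l \<alpha>" "w \<in> weyl_group l \<alpha>"
  shows "weyl_sign l \<alpha> (v \<circ> w) = weyl_sign l \<alpha> v * weyl_sign l \<alpha> w"
proof -
  obtain p s q t where *: "signed_perm v p s" "perm_sign p s = weyl_sign l \<alpha> v"
     "signed_perm w q t" "perm_sign q t = weyl_sign l \<alpha> w"
    using assms weyl_signed_perm by metis
  show ?thesis
    using weyl_sign_eq[OF comp_weyl[OF assms] signed_perm_comp[OF *(1,3)]] perm_sign_comp[OF *(1,3)] *
    by simp
qed

lemma weyl_sign_id: "weyl_sign l \<alpha> id = 1"
  using weyl_sign_word[of "[]"] by (simp add: word_prod_Nil)

lemma weyl_sign_refl: "i \<in> {1..l} \<Longrightarrow> weyl_sign l \<alpha> (refl_root (\<alpha> i)) = - 1"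
  using weyl_sign_word[of "[i]"] by (simp add: word_prod_Cons word_prod_Nil)

lemma weyl_sign_square: "weyl_sign l \<alpha> w * weyl_sign l \<alpha> w = 1"
  unfolding weyl_sign_def by (simp flip: power_add)

lemma weyl_linear: "w \<in> weyl_group l \<alpha> \<Longrightarrow> linear w"
proof -
  assume "w \<in> weyl_group l \<alpha>"
  then obtain p s where ps: "signed_perm w p s" using weyl_signed_perm by blast
  show ?thesis
    by (rule linearI; rule coord_eqI) (simp_all add: signed_permD[OF ps] inner_add_left algebra_simps)
qed

lemma refl_involution: "\<beta> \<bullet> \<beta> \<noteq> 0 \<Longrightarrow> refl_root \<beta> (refl_root \<beta> x) = x"
  by (simp add: refl_root_def nu_coroot_def algebra_simps inner_diff_left)

lemma weyl_inverse_exists: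
  assumes "w \<in> weyl_group l \<alpha>"
  shows "\<exists>v\<in>weyl_group l \<alpha>. v \<circ> w = id \<and> w \<circ> v = id"
proof -
  obtain js where js: "set js \<subseteq> {1..l}" "w = word_prod \<alpha> js" using assms by (auto simp: weyl_group_def)
  have inv: "refl_root (\<alpha> i) \<circ> refl_root (\<alpha> i) = id" if "i \<in> {1..l}" for i
    using alpha_norm_nonzero[OF that] by (auto simp: refl_involution)
  have 1: "word_prod \<alpha> (rev ks) \<circ> word_prod \<alpha> ks = id" if "set ks \<subseteq> {1..l}" for ks
    using that
  proof (induction ks)
    case (Cons i ks)
    have "word_prod \<alpha> (rev (i # ks)) \<circ> word_prod \<alpha> (i # ks) =
      word_prod \<alpha> (rev ks) \<circ> (refl_root (\<alpha> i) \<circ> refl_root (\<alpha> i)) \<circ> word_prod \<alpha> ks"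
      by (simp add: word_prod_append word_prod_Cons word_prod_Nil comp_assoc)
    then show ?case using Cons inv[of i] by simp
  qed (simp add: word_prod_Nil)
  have "word_prod \<alpha> (rev js) \<in> weyl_group l \<alpha>"
    unfolding weyl_group_def using js by (intro CollectI exI[of _ "rev js"]) simp
  with 1[of js] 1[of "rev js"] js show ?thesis by auto
qed

lemma weyl_isometry: "w \<in> weyl_group l \<alpha> \<Longrightarrow> w x \<bullet> w y = x \<bullet> y"
proof -
  assume "w \<in> weyl_group l \<alpha>"
  then obtain p s where ps: "signed_perm w p s" using weyl_signed_perm by blast
  have "w x \<bullet> w y = (\<Sum>j\<in>{1..l}. (x \<bullet> e (p j)) * (y \<bullet> e (p j)))"
    unfolding inner_coord[of "w x" "w y"]
  proof (rule sum.cong)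
    fix i assume i: "i \<in> {1..l}"
    show "(w x \<bullet> e i) * (w y \<bullet> e i) = (x \<bullet> e (p i)) * (y \<bullet> e (p i))"
      using signed_permD(2,3)[OF ps i] by auto
  qed simp
  also have "\<dots> = x \<bullet> y"
    unfolding inner_coord[of x y]
    using sum.permute[OF signed_permD(1)[OF ps], of "\<lambda>j. (x \<bullet> e j) * (y \<bullet> e j)"] by (simp add: comp_def)
  finally show ?thesis .
qed

lemma weyl_adjoint:
  "w \<in> weyl_group l \<alpha> \<Longrightarrow> v \<circ> w = id \<Longrightarrow> w \<circ> v = id \<Longrightarrow> x \<bullet> w y = v x \<bullet> y"
  using weyl_isometry[of w "v x" y] by (metis comp_apply id_apply)

lemma finite_weyl: "finite (weyl_group l \<alpha>)"
proof -
  \<comment> \<open>A signed permutation determines the map, and restricting \<open>s\<close> to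
    \<open>{1..l}\<close> puts the parameters into a finite set.\<close>
  let ?f = "\<lambda>(p, s) x. \<Sum>i\<in>{1..l}. (of_int (s i) * (x \<bullet> e (p i))) *\<^sub>R e i"
  have "weyl_group l \<alpha> \<subseteq> ?f ` ({p. p permutes {1..l}} \<times> PiE {1..l} (\<lambda>_. {1, - 1}))"
  proof
    fix w assume "w \<in> weyl_group l \<alpha>"
    then obtain p s where ps: "signed_perm w p s" using weyl_signed_perm by blast
    have "w x = ?f (p, restrict s {1..l}) x" for x
      by (rule coord_eqI) (simp add: coord_sum signed_permD(3)[OF ps] del: One_nat_def)
    then have "w = ?f (p, restrict s {1..l})" by blast
    moreover have "(p, restrict s {1..l}) \<in> {p. p permutes {1..l}} \<times> PiE {1..l} (\<lambda>_. {1, - 1})"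
      using signed_permD(1,2)[OF ps] by auto
    ultimately show "w \<in> ?f ` ({p. p permutes {1..l}} \<times> PiE {1..l} (\<lambda>_. {1, - 1}))"
      by (rule image_eqI)
  qed
  moreover have "finite ({p. p permutes {1..l}} \<times> PiE {1..l} (\<lambda>_. {1, - 1 :: int}))"
    by (intro finite_cartesian_product finite_permutations finite_PiE) auto
  ultimately show ?thesis using finite_surj by blast
qed

end

section \<open>The coroot lattice and the Weyl vector\<close>

context C_roots
begin

definition int_vec :: "'a set" where
  "int_vec = {x. \<forall>i\<in>{1..l}. x \<bullet> e i \<in> \<int>}"

lemma int_vec_coord: "x \<in> int_vec \<Longrightarrow> i \<in> {1..l} \<Longrightarrow> x \<bullet> e i \<in> \<int>"
  by (simp add: int_vec_def)

lemma int_vec_zero: "0 \<in> int_vec"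
  by (simp add: int_vec_def)

lemma int_vec_add: "x \<in> int_vec \<Longrightarrow> y \<in> int_vec \<Longrightarrow> x + y \<in> int_vec"
  by (simp add: int_vec_def inner_add_left)

lemma int_vec_diff: "x \<in> int_vec \<Longrightarrow> y \<in> int_vec \<Longrightarrow> x - y \<in> int_vec"
  by (simp add: int_vec_def inner_diff_left)

lemma int_vec_scale: "x \<in> int_vec \<Longrightarrow> c \<in> \<int> \<Longrightarrow> c *\<^sub>R x \<in> int_vec"
  by (simp add: int_vec_def)

lemma int_vec_sum: "(\<And>i. i \<in> I \<Longrightarrow> f i \<in> int_vec) \<Longrightarrow> (\<Sum>i\<in>I. f i) \<in> int_vec"
  by (induction I rule: infinite_finite_induct) (auto simp: int_vec_zero int_vec_add)

lemma int_vec_e: "i \<in> {1..l} \<Longrightarrow> e i \<in> int_vec"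
  by (auto simp: int_vec_def e_inner)

lemma int_vec_inner: "x \<in> int_vec \<Longrightarrow> y \<in> int_vec \<Longrightarrow> x \<bullet> y \<in> \<int>"
  unfolding inner_coord[of x y] by (intro Ints_sum Ints_mult) (auto simp: int_vec_def)

lemma int_vec_weyl:
  assumes "w \<in> weyl_group l \<alpha>" "x \<in> int_vec"
  shows "w x \<in> int_vec"
proof -
  obtain p s where ps: "signed_perm w p s" using assms weyl_signed_perm by blast
  show ?thesis
    unfolding int_vec_def using assms(2) signed_permD(3,4)[OF ps] by (auto simp: int_vec_def)
qed

lemma nu_coroot_int_vec: "i \<in> {1..l} \<Longrightarrow> nu_coroot (\<alpha> i) \<in> int_vec"
  using int_vec_e[of i] int_vec_e[of "Suc i"]
  by (cases "i = l") (auto simp: nu_coroot_short nu_coroot_long int_vec_diff)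

lemma lattice_add:
  assumes "x \<in> nu_coroot_lattice l \<alpha>" "y \<in> nu_coroot_lattice l \<alpha>"
  shows "x + y \<in> nu_coroot_lattice l \<alpha>"
proof -
  obtain c d :: "nat \<Rightarrow> int" where
    "x = (\<Sum>i\<in>{1..l}. of_int (c i) *\<^sub>R nu_coroot (\<alpha> i))"
    "y = (\<Sum>i\<in>{1..l}. of_int (d i) *\<^sub>R nu_coroot (\<alpha> i))"
    using assms by (auto simp: nu_coroot_lattice_def)
  then show ?thesis
    unfolding nu_coroot_lattice_def
    by (intro CollectI exI[of _ "\<lambda>i. c i + d i"]) (simp add: scaleR_add_left sum.distrib)
qed

lemma lattice_scale:
  assumes "x \<in> nu_coroot_lattice l \<alpha>"
  shows "of_int a *\<^sub>R x \<in> nu_coroot_lattice l \<alpha>"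
proof -
  obtain c :: "nat \<Rightarrow> int" where "x = (\<Sum>i\<in>{1..l}. of_int (c i) *\<^sub>R nu_coroot (\<alpha> i))"
    using assms by (auto simp: nu_coroot_lattice_def)
  then show ?thesis
    unfolding nu_coroot_lattice_def
    by (intro CollectI exI[of _ "\<lambda>i. a * c i"]) (simp add: scaleR_sum_right)
qed

lemma lattice_coroot: "i \<in> {1..l} \<Longrightarrow> nu_coroot (\<alpha> i) \<in> nu_coroot_lattice l \<alpha>"
  unfolding nu_coroot_lattice_def
  by (intro CollectI exI[of _ "\<lambda>j. if j = i then 1 else 0"])
    (simp add: if_distrib[of "\<lambda>c. c *\<^sub>R _"] if_distrib[of of_int] sum.delta' cong: if_cong)

lemma lattice_e:
  assumes "1 \<le> i" "i \<le> l"
  shows "e i \<in> nu_coroot_lattice l \<alpha>"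
  using assms(2,1)
proof (induction rule: inc_induct)
  case base
  then show ?case using lattice_coroot[of l] by (simp add: nu_coroot_long)
next
  case (step i)
  then show ?case
    using lattice_add[OF lattice_coroot[of i] step(3)] by (simp add: nu_coroot_short)
qed

text \<open>Coroots telescope: those of \<open>\<alpha> i, ..., \<alpha> l\<close> add up to
  \<open>e i\<close>, so the \<open>e i\<close> form a basis of the coroot lattice.\<close>

lemma lattice_eq: "nu_coroot_lattice l \<alpha> = int_vec"
proof
  show "nu_coroot_lattice l \<alpha> \<subseteq> int_vec"
    unfolding nu_coroot_lattice_def
    by (auto intro!: int_vec_sum int_vec_scale nu_coroot_int_vec)
  show "int_vec \<subseteq> nu_coroot_lattice l \<alpha>"
  proof
    fix x assume x: "x \<in> int_vec"
    have z: "0 \<in> nu_coroot_lattice l \<alpha>"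
      using lattice_scale[OF lattice_coroot[of 1], of 0] l_pos by simp
    have "(\<Sum>j\<in>J. (x \<bullet> e j) *\<^sub>R e j) \<in> nu_coroot_lattice l \<alpha>" if "J \<subseteq> {1..l}" for J
      using finite_subset[OF that finite_atLeastAtMost] that
    proof (induction J)
      case (insert j J)
      then obtain a where "x \<bullet> e j = of_int a" using x int_vec_coord[of x j] by (auto elim: Ints_cases)
      then show ?case using insert lattice_add lattice_scale[OF lattice_e[of j], of a] by simp
    qed (simp add: z)
    then show "x \<in> nu_coroot_lattice l \<alpha>" using coord_expand[of x] by (metis order_refl)
  qed
qed

section \<open>Positive roots and the Weyl vector\<close>

definition root_cone :: "'a set" where
  "root_cone = {\<Sum>i\<in>{1..l}. of_nat (c i) *\<^sub>R \<alpha> i | c :: nat \<Rightarrow> nat. True}"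

lemma root_cone_zero: "0 \<in> root_cone"
  unfolding root_cone_def by (intro CollectI exI[of _ "\<lambda>_. 0"]) simp

lemma root_cone_add: "x \<in> root_cone \<Longrightarrow> y \<in> root_cone \<Longrightarrow> x + y \<in> root_cone"
  unfolding root_cone_def
proof clarify
  fix c d :: "nat \<Rightarrow> nat"
  show "\<exists>b. (\<Sum>i\<in>{1..l}. of_nat (c i) *\<^sub>R \<alpha> i) + (\<Sum>i\<in>{1..l}. of_nat (d i) *\<^sub>R \<alpha> i) =
      (\<Sum>i\<in>{1..l}. of_nat (b i) *\<^sub>R \<alpha> i) \<and> True"
    by (intro exI[of _ "\<lambda>i. c i + d i"]) (simp add: scaleR_add_left sum.distrib)
qed

lemma root_cone_alpha: "i \<in> {1..l} \<Longrightarrow> \<alpha> i \<in> root_cone"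
  unfolding root_cone_def
  by (intro CollectI exI[of _ "\<lambda>j. if j = i then 1 else 0"])
    (simp add: if_distrib[of "\<lambda>c. c *\<^sub>R _"] if_distrib[of of_nat] sum.delta' cong: if_cong)

lemma root_cone_diff:
  assumes "1 \<le> a" "a \<le> b" "b \<le> l"
  shows "e a - e b \<in> root_cone"
  using assms(2,1)
proof (induction rule: inc_induct)
  case base
  then show ?case by (simp add: root_cone_zero)
next
  case (step a)
  then have "\<alpha> a + (e (Suc a) - e b) \<in> root_cone"
    using assms by (intro root_cone_add root_cone_alpha) auto
  then show ?case using step assms by (simp add: alpha_short)
qed

lemma root_cone_sum:
  assumes "a \<in> {1..l}" "b \<in> {1..l}"
  shows "e a + e b \<in> root_cone"
proof -
  have "(e a - e l) + (e b - e l) + \<alpha> l \<in> root_cone"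
    using assms by (intro root_cone_add root_cone_alpha root_cone_diff) auto
  then show ?thesis by (simp add: alpha_long algebra_simps scaleR_2)
qed

lemma weyl_e:
  assumes "w \<in> weyl_group l \<alpha>" "j \<in> {1..l}"
  shows "\<exists>a\<in>{1..l}. w (e j) = e a \<or> w (e j) = - e a"
proof -
  obtain p s where ps: "signed_perm w p s" using assms weyl_signed_perm by blast
  have "p ` {1..l} = {1..l}" using signed_permD(1)[OF ps] by (rule permutes_image)
  then obtain a where a: "a \<in> {1..l}" "p a = j" using assms(2) by (metis imageE)
  have "w (e j) = of_int (s a) *\<^sub>R e a"
  proof (rule coord_eqI)
    fix i assume i: "i \<in> {1..l}"
    have "p i = p a \<longleftrightarrow> i = a" using permutes_inj[OF signed_permD(1)[OF ps]] by (auto dest: injD)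
    then show "w (e j) \<bullet> e i = of_int (s a) *\<^sub>R e a \<bullet> e i"
      using i a signed_permD(3,4)[OF ps i] assms(2) by (auto simp: e_inner)
  qed
  then show ?thesis using signed_permD(2)[OF ps a(1)] a(1) by auto
qed

text \<open>Every root is a difference \<open>e a - e b\<close> or, up to sign, a sum
  \<open>e a + e b\<close>, with \<open>a = b\<close> for the long ones; in a difference the order
  of \<open>a\<close> and \<open>b\<close> decides the sign.\<close>

lemma root_pos_or_neg:
  assumes "\<beta> \<in> roots l \<alpha>"
  shows "\<beta> \<in> root_cone \<or> - \<beta> \<in> root_cone"
proof -
  obtain w i where w: "w \<in> weyl_group l \<alpha>" and i: "i \<in> {1..l}" and \<beta>: "\<beta> = w (\<alpha> i)"
    using assms by (auto simp: roots_def)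
  interpret linear w using weyl_linear[OF w] .
  have *: "e a - e b \<in> root_cone \<or> e b - e a \<in> root_cone" if "a \<in> {1..l}" "b \<in> {1..l}" for a b
    using that root_cone_diff[of a b] root_cone_diff[of b a] by (cases "a \<le> b") auto
  show ?thesis
  proof (cases "i = l")
    case True
    obtain a where a: "a \<in> {1..l}" "w (e l) = e a \<or> w (e l) = - e a" using weyl_e[OF w, of l] l_pos by auto
    have "\<beta> = w (e l) + w (e l)" using True by (simp add: \<beta> alpha_long scaleR_2 add)
    then show ?thesis using a root_cone_sum[of a a] by auto
  next
    case False
    obtain a where a: "a \<in> {1..l}" "w (e i) = e a \<or> w (e i) = - e a" using weyl_e[OF w, of i] i by auto
    obtain b where b: "b \<in> {1..l}" "w (e (Suc i)) = e b \<or> w (e (Suc i)) = - e b"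
      using weyl_e[OF w, of "Suc i"] i False by auto
    have "\<beta> = w (e i) - w (e (Suc i))" using False i by (simp add: \<beta> alpha_short diff)
    then show ?thesis using a b root_cone_sum[of a b] *[of a b] by (auto simp: add.commute)
  qed
qed

text \<open>Dual to the simple roots up to a factor 2 at the long one, so pairing with
  \<open>coweight j\<close> reads off the coefficient of \<open>\<alpha> j\<close>.\<close>

definition coweight :: "nat \<Rightarrow> 'a" where
  "coweight j = (\<Sum>i\<in>{1..j}. e i)"

lemma e_coweight:
  assumes "i \<in> {1..l}" "j \<le> l"
  shows "e i \<bullet> coweight j = (if i \<le> j then 1 else 0)"
proof -
  have "e i \<bullet> coweight j = (\<Sum>m\<in>{1..j}. if m = i then 1 else 0)"
    unfolding coweight_def inner_sum_right using assms by (intro sum.cong) (auto simp: e_inner)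
  then show ?thesis using assms by auto
qed

lemma alpha_coweight:
  assumes "i \<in> {1..l}" "j \<in> {1..l}"
  shows "\<alpha> i \<bullet> coweight j = (if i = j then (if i = l then 2 else 1) else 0)"
  using assms by (cases "i = l") (auto simp: alpha_long alpha_short inner_diff_left e_coweight)

lemma sum_alpha_coweight:
  "j \<in> {1..l} \<Longrightarrow> (\<Sum>i\<in>{1..l}. c i *\<^sub>R \<alpha> i) \<bullet> coweight j = (if j = l then 2 else 1) * c j"
  by (simp add: inner_sum_left alpha_coweight if_distrib[of "(*) _"] sum.delta cong: if_cong del: One_nat_def)

lemma root_cone_coweight: "x \<in> root_cone \<Longrightarrow> j \<in> {1..l} \<Longrightarrow> 0 \<le> x \<bullet> coweight j"
  unfolding root_cone_def by (auto simp: sum_alpha_coweight simp del: One_nat_def)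

lemma positive_roots_eq: "positive_roots l \<alpha> = roots l \<alpha> \<inter> root_cone"
  by (auto simp: positive_roots_def root_cone_def)

lemma finite_positive_roots: "finite (positive_roots l \<alpha>)"
proof -
  have "roots l \<alpha> = (\<lambda>(w, i). w (\<alpha> i)) ` (weyl_group l \<alpha> \<times> {1..l})"
    unfolding roots_def by auto blast
  then have "finite (roots l \<alpha>)" using finite_weyl by simp
  then show ?thesis by (simp add: positive_roots_eq)
qed

lemma alpha_norm_cases: "i \<in> {1..l} \<Longrightarrow> \<alpha> i \<bullet> \<alpha> i = 2 \<or> \<alpha> i \<bullet> \<alpha> i = 4"
  using alpha_norm[of i] alpha_last_norm by (cases "i = l") auto

text \<open>Otherwise \<open>\<beta>\<close> would be a natural multiple of
  \<open>\<alpha> i\<close>. Squared lengths are 2 or 4, which rules out the factor 0 and all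
  factors from 2 on; the factor 1 is excluded by hypothesis.\<close>

lemma positive_root_coweight:
  assumes "\<beta> \<in> positive_roots l \<alpha>" "i \<in> {1..l}" "\<beta> \<noteq> \<alpha> i"
  shows "\<exists>j\<in>{1..l}. j \<noteq> i \<and> 0 < \<beta> \<bullet> coweight j"
proof (rule ccontr)
  assume *: "\<not> ?thesis"
  obtain c :: "nat \<Rightarrow> nat" where \<beta>: "\<beta> = (\<Sum>i\<in>{1..l}. of_nat (c i) *\<^sub>R \<alpha> i)"
    using assms by (auto simp: positive_roots_def)
  have "c j = 0" if "j \<in> {1..l}" "j \<noteq> i" for j
    using * that sum_alpha_coweight[OF that(1), of "\<lambda>i. of_nat (c i)"] unfolding \<beta>
    by (auto split: if_splits)
  then have "\<beta> = (\<Sum>j\<in>{1..l}. if j = i then of_nat (c i) *\<^sub>R \<alpha> i else 0)"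
    unfolding \<beta> by (intro sum.cong) auto
  then have \<beta>': "\<beta> = of_nat (c i) *\<^sub>R \<alpha> i" using assms(2) by simp
  obtain w j where "w \<in> weyl_group l \<alpha>" and j: "j \<in> {1..l}" and "\<beta> = w (\<alpha> j)"
    using assms(1) by (auto simp: positive_roots_def roots_def)
  then have "\<beta> \<bullet> \<beta> = \<alpha> j \<bullet> \<alpha> j" using weyl_isometry by simp
  then have eq: "real (c i * c i) * (\<alpha> i \<bullet> \<alpha> i) = \<alpha> j \<bullet> \<alpha> j" by (simp add: \<beta>')
  have c: "c i \<noteq> 1" using assms(3) \<beta>' by auto
  have "c i = 0 \<or> 4 \<le> c i * c i"
  proof (cases "c i = 0")
    case False
    then have "2 \<le> c i" using c by simp
    then show ?thesis using mult_le_mono[of 2 "c i" 2 "c i"] by simp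
  qed simp
  then show False
  proof
    assume "c i = 0"
    then show False using eq alpha_norm_cases[OF j] by auto
  next
    assume "4 \<le> c i * c i"
    then have "4 \<le> real (c i * c i)" by linarith
    then show False using eq alpha_norm_cases[OF j] alpha_norm_cases[OF assms(2)] by auto
  qed
qed

lemma refl_root_inner: "refl_root \<beta> x \<bullet> y = x \<bullet> refl_root \<beta> y"
  by (simp add: refl_root_def nu_coroot_def inner_diff_left inner_diff_right inner_commute)

lemma refl_root_roots: "\<beta> \<in> roots l \<alpha> \<Longrightarrow> i \<in> {1..l} \<Longrightarrow> refl_root (\<alpha> i) \<beta> \<in> roots l \<alpha>"
  unfolding roots_def
proof clarify
  fix w j assume "i \<in> {1..l}" "w \<in> weyl_group l \<alpha>" "j \<in> {1..l}"
  then show "\<exists>v m. refl_root (\<alpha> i) (w (\<alpha> j)) = v (\<alpha> m) \<and> v \<in> weyl_group l \<alpha> \<and> m \<in> {1..l}"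
    by (intro exI[of _ "refl_root (\<alpha> i) \<circ> w"] exI[of _ j]) (simp add: comp_weyl refl_weyl)
qed

lemma refl_alpha: "i \<in> {1..l} \<Longrightarrow> refl_root (\<alpha> i) (\<alpha> i) = - \<alpha> i"
  using alpha_norm_nonzero[of i] by (simp add: refl_root_def nu_coroot_def scaleR_2 algebra_simps)

text \<open>The reflection changes only the coefficient of \<open>\<alpha> i\<close>; some other
  coefficient of \<open>\<beta>\<close> is positive and survives, and a root with one positive
  coefficient is positive.\<close>

lemma refl_positive_roots:
  assumes "i \<in> {1..l}" "\<beta> \<in> positive_roots l \<alpha> - {\<alpha> i}"
  shows "refl_root (\<alpha> i) \<beta> \<in> positive_roots l \<alpha> - {\<alpha> i}"
proof -
  have \<beta>: "\<beta> \<in> roots l \<alpha>" "\<beta> \<in> root_cone" "\<beta> \<noteq> \<alpha> i" using assms by (auto simp: positive_roots_eq)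
  obtain j where j: "j \<in> {1..l}" "j \<noteq> i" "0 < \<beta> \<bullet> coweight j"
    using positive_root_coweight[of \<beta> i] assms by auto
  have "refl_root (\<alpha> i) \<beta> \<bullet> coweight j = \<beta> \<bullet> coweight j"
    using j assms by (simp add: refl_root_def inner_diff_left alpha_coweight)
  then have "- refl_root (\<alpha> i) \<beta> \<notin> root_cone"
    using root_cone_coweight[of "- refl_root (\<alpha> i) \<beta>" j] j by auto
  moreover have "refl_root (\<alpha> i) \<beta> \<noteq> \<alpha> i"
  proof
    assume "refl_root (\<alpha> i) \<beta> = \<alpha> i"
    then have "\<beta> = - \<alpha> i" using refl_involution[OF alpha_norm_nonzero[OF assms(1)], of \<beta>] refl_alpha[OF assms(1)] by simp
    then show False using root_cone_coweight[OF \<beta>(2) assms(1)] assms(1) by (auto simp: alpha_coweight split: if_splits)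
  qed
  ultimately show ?thesis
    using root_pos_or_neg[OF refl_root_roots[OF \<beta>(1) assms(1)]] refl_root_roots[OF \<beta>(1) assms(1)]
    by (auto simp: positive_roots_eq)
qed

text \<open>The reflection in \<open>\<alpha> i\<close> permutes the positive roots other than \<open>\<alpha> i\<close>.\<close>

lemma rho_coroot:
  assumes i: "i \<in> {1..l}"
  shows "rho l \<alpha> \<bullet> nu_coroot (\<alpha> i) = 1"
proof -
  let ?P = "positive_roots l \<alpha> - {\<alpha> i}"
  let ?r = "refl_root (\<alpha> i)"
  have inv: "?r (?r x) = x" for x using refl_involution[OF alpha_norm_nonzero[OF i]] .
  have "(\<Sum>\<beta>\<in>?P. \<beta> \<bullet> \<alpha> i) = (\<Sum>\<beta>\<in>?P. ?r \<beta> \<bullet> \<alpha> i)"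
    by (rule sum.reindex_bij_witness[of _ ?r ?r]) (use inv refl_positive_roots[OF i] in auto)
  also have "\<dots> = - (\<Sum>\<beta>\<in>?P. \<beta> \<bullet> \<alpha> i)"
    by (simp add: refl_root_inner refl_alpha[OF i] sum_negf)
  finally have 0: "(\<Sum>\<beta>\<in>?P. \<beta> \<bullet> \<alpha> i) = 0" by simp
  have "\<alpha> i = id (\<alpha> i)" by simp
  then have "\<alpha> i \<in> positive_roots l \<alpha>"
    using id_weyl i root_cone_alpha[OF i] unfolding positive_roots_eq roots_def by blast
  then have "(\<Sum>\<beta>\<in>positive_roots l \<alpha>. \<beta> \<bullet> \<alpha> i) = \<alpha> i \<bullet> \<alpha> i"
    using sum.remove[OF finite_positive_roots, of "\<alpha> i" "\<lambda>\<beta>. \<beta> \<bullet> \<alpha> i"] 0 by simp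
  then have "2 * (rho l \<alpha> \<bullet> \<alpha> i) = \<alpha> i \<bullet> \<alpha> i"
    by (simp add: rho_def inner_sum_left)
  then show ?thesis using alpha_norm_nonzero[OF i] by (simp add: nu_coroot_def)
qed

text \<open>Downward induction over the coroot pairings gives the vector \<open>(l, ..., 1)\<close>.
  In particular \<open>(\<rho>, \<theta>) = 2 l\<close>, the shift that turns levels into
  alcoves.\<close>

lemma rho_coord:
  assumes "1 \<le> i" "i \<le> l"
  shows "rho l \<alpha> \<bullet> e i = of_nat (l + 1 - i)"
  using assms(2,1)
proof (induction rule: inc_induct)
  case base
  then show ?case using rho_coroot[of l] by (simp add: nu_coroot_long)
next
  case (step i)
  then show ?case using rho_coroot[of i] by (simp add: nu_coroot_short inner_diff_right)
qed

lemma rho_int_vec: "rho l \<alpha> \<in> int_vec"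
  by (auto simp: int_vec_def rho_coord)

end

section \<open>The affine Weyl group and its alcove\<close>

lemma Ints_gt_neg_one_Nats:
  fixes z :: real
  assumes "z \<in> \<int>" "0 < z + 1"
  shows "z \<in> \<nat>"
  using assms by (auto simp: Nats_altdef2 elim!: Ints_cases)

context C_roots
begin

definition alcove :: "nat \<Rightarrow> 'a set" where
  "alcove M = {p \<in> int_vec. (\<forall>i\<in>{1..<l}. p \<bullet> e (Suc i) < p \<bullet> e i) \<and> 0 < p \<bullet> e l \<and>
     2 * (p \<bullet> e 1) < of_nat M}"

lemma alcove_int_vec: "p \<in> alcove M \<Longrightarrow> p \<in> int_vec"
  by (simp add: alcove_def)

lemma alcove_decreasing:
  assumes "p \<in> alcove M" "1 \<le> i" "i < j" "j \<le> l"
  shows "p \<bullet> e j < p \<bullet> e i"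
  using assms(3,2)
proof (induction rule: strict_inc_induct)
  case (base i)
  then show ?case using assms by (auto simp: alcove_def)
next
  case (step i)
  then have "p \<bullet> e (Suc i) < p \<bullet> e i" using assms by (auto simp: alcove_def)
  with step show ?case by simp
qed

lemma alcove_bounds:
  assumes "p \<in> alcove M" "i \<in> {1..l}"
  shows "0 < p \<bullet> e i" "2 * (p \<bullet> e i) < of_nat M"
proof -
  show "0 < p \<bullet> e i"
    using alcove_decreasing[OF assms(1), of i l] assms by (cases "i = l") (auto simp: alcove_def)
  show "2 * (p \<bullet> e i) < of_nat M"
    using alcove_decreasing[OF assms(1), of 1 i] assms by (cases "i = 1") (auto simp: alcove_def)
qed

lemma monotone_permutation_id:
  assumes "p permutes {1..l}" "\<And>i. 1 \<le> i \<Longrightarrow> i < l \<Longrightarrow> p i < p (Suc i)"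
  shows "p = id"
proof (rule permutes_natset_ge[OF assms(1)])
  have "i \<le> p i" if "1 \<le> i" "i \<le> l" for i
    using that
  proof (induction i rule: dec_induct)
    case base
    then show ?case using permutes_in_image[OF assms(1), of 1] by auto
  next
    case (step i)
    then show ?case using assms(2)[of i] by simp
  qed
  then show "\<forall>i\<in>{1..l}. i \<le> p i" by simp
qed

text \<open>All coordinates of both points lie strictly between 0 and \<open>M / 2\<close>, which
  leaves no room for a sign change or for a nonzero multiple of \<open>M\<close>. What remains is a
  permutation between two strictly decreasing sequences.\<close>

lemma alcove_unique:
  assumes w: "w \<in> weyl_group l \<alpha>" and t: "t \<in> int_vec"
    and p: "p \<in> alcove M" and r: "w p + of_nat M *\<^sub>R t \<in> alcove M"
  shows "w = id" "t = 0"
proof -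
  let ?r = "w p + of_nat M *\<^sub>R t"
  obtain \<sigma> s where ps: "signed_perm w \<sigma> s" using w weyl_signed_perm by blast
  have M: "0 < real M" using alcove_bounds[OF p, of l] l_pos by auto
  have *: "s i = 1 \<and> t \<bullet> e i = 0" if i: "i \<in> {1..l}" for i
  proof -
    obtain a where a: "t \<bullet> e i = of_int a" using int_vec_coord[OF t i] by (auto elim: Ints_cases)
    have ri: "?r \<bullet> e i = of_int (s i) * (p \<bullet> e (\<sigma> i)) + of_nat M * of_int a"
      using signed_permD(3)[OF ps i] by (simp add: inner_add_left a)
    have ri': "?r \<bullet> e i = p \<bullet> e (\<sigma> i) + of_nat M * of_int a \<or>
        ?r \<bullet> e i = - (p \<bullet> e (\<sigma> i)) + of_nat M * of_int a"
      using signed_permD(2)[OF ps i] by (auto simp: ri)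
    note bp = alcove_bounds[OF p signed_permD(4)[OF ps i]] and br = alcove_bounds[OF r i]
    have "a < 1"
    proof (rule ccontr)
      assume "\<not> a < 1"
      then have h: "of_nat M * 1 \<le> real M * of_int a" by (intro mult_left_mono) auto
      show False by (rule disjE[OF ri']) (use bp br h in linarith)+
    qed
    have "- 1 < a"
    proof (rule ccontr)
      assume "\<not> - 1 < a"
      then have h: "real M * of_int a \<le> of_nat M * (- 1)" by (intro mult_left_mono) auto
      show False by (rule disjE[OF ri']) (use bp br h in linarith)+
    qed
    with \<open>a < 1\<close> have "a = 0" by simp
    then show ?thesis using bp br signed_permD(2)[OF ps i] a unfolding ri by auto
  qed
  have rp: "?r \<bullet> e i = p \<bullet> e (\<sigma> i)" if "i \<in> {1..l}" for i
    using *[OF that] signed_permD(3)[OF ps that] by (simp add: inner_add_left)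
  have "\<sigma> i < \<sigma> (Suc i)" if i: "1 \<le> i" "i < l" for i
  proof -
    have "p \<bullet> e (\<sigma> (Suc i)) < p \<bullet> e (\<sigma> i)"
      using alcove_decreasing[OF r, of i "Suc i"] rp[of i] rp[of "Suc i"] i by simp
    moreover have "\<sigma> i \<in> {1..l}" "\<sigma> (Suc i) \<in> {1..l}" using signed_permD(4)[OF ps] i by auto
    ultimately show ?thesis
      using alcove_decreasing[OF p, of "\<sigma> (Suc i)" "\<sigma> i"] by (cases "\<sigma> i = \<sigma> (Suc i)") force+
  qed
  then have "\<sigma> = id" using monotone_permutation_id signed_permD(1)[OF ps] by blast
  then have "w x = x" for x
    using signed_permD(3)[OF ps] * by (intro coord_eqI) simp
  then show "w = id" by auto
  show "t = 0" by (rule coord_eqI) (use * in simp)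
qed

lemma affine_weyl_group_eq:
  "affine_weyl_group l \<alpha> M = {\<lambda>x. w x + of_nat M *\<^sub>R t | w t. w \<in> weyl_group l \<alpha> \<and> t \<in> int_vec}"
  by (simp add: affine_weyl_group_def lattice_eq)

lemma affine_weyl_groupI:
  "w \<in> weyl_group l \<alpha> \<Longrightarrow> t \<in> int_vec \<Longrightarrow> (\<lambda>x. w x + of_nat M *\<^sub>R t) \<in> affine_weyl_group l \<alpha> M"
  unfolding affine_weyl_group_eq by blast

lemma affine_sign_eq:
  "w \<in> weyl_group l \<alpha> \<Longrightarrow> affine_sign l \<alpha> (\<lambda>x. w x + t) = weyl_sign l \<alpha> w"
  using linear_0[OF weyl_linear[of w]] by (simp add: affine_sign_def)

lemma affine_weyl_groupE:
  assumes "g \<in> affine_weyl_group l \<alpha> M"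
  obtains w t where "w \<in> weyl_group l \<alpha>" "t \<in> int_vec" "g = (\<lambda>x. w x + of_nat M *\<^sub>R t)"
    "affine_sign l \<alpha> g = weyl_sign l \<alpha> w"
  using assms affine_sign_eq unfolding affine_weyl_group_eq by blast

lemma affine_comp:
  assumes "g \<in> affine_weyl_group l \<alpha> M" "h \<in> affine_weyl_group l \<alpha> M"
  shows "g \<circ> h \<in> affine_weyl_group l \<alpha> M"
    "affine_sign l \<alpha> (g \<circ> h) = affine_sign l \<alpha> g * affine_sign l \<alpha> h"
proof -
  obtain v s where g: "v \<in> weyl_group l \<alpha>" "s \<in> int_vec" "g = (\<lambda>x. v x + of_nat M *\<^sub>R s)"
    "affine_sign l \<alpha> g = weyl_sign l \<alpha> v" using affine_weyl_groupE[OF assms(1)] .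
  obtain w t where h: "w \<in> weyl_group l \<alpha>" "t \<in> int_vec" "h = (\<lambda>x. w x + of_nat M *\<^sub>R t)"
    "affine_sign l \<alpha> h = weyl_sign l \<alpha> w" using affine_weyl_groupE[OF assms(2)] .
  have eq: "g \<circ> h = (\<lambda>x. (v \<circ> w) x + of_nat M *\<^sub>R (v t + s))"
    using linear_add[OF weyl_linear[OF g(1)]] linear_scale[OF weyl_linear[OF g(1)]]
    by (simp add: g(3) h(3) fun_eq_iff scaleR_add_right)
  show "g \<circ> h \<in> affine_weyl_group l \<alpha> M"
    unfolding eq
    by (rule affine_weyl_groupI[OF comp_weyl[OF g(1) h(1)] int_vec_add[OF int_vec_weyl[OF g(1) h(2)] g(2)]])
  show "affine_sign l \<alpha> (g \<circ> h) = affine_sign l \<alpha> g * affine_sign l \<alpha> h"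
    unfolding eq affine_sign_eq[OF comp_weyl[OF g(1) h(1)]] g(4) h(4)
    by (rule weyl_sign_comp[OF g(1) h(1)])
qed

lemma affine_inverse:
  assumes "g \<in> affine_weyl_group l \<alpha> M"
  shows "\<exists>h\<in>affine_weyl_group l \<alpha> M. h \<circ> g = id \<and> g \<circ> h = id"
proof -
  obtain w t where g: "w \<in> weyl_group l \<alpha>" "t \<in> int_vec" "g = (\<lambda>x. w x + of_nat M *\<^sub>R t)"
    using affine_weyl_groupE[OF assms] .
  obtain v where v: "v \<in> weyl_group l \<alpha>" "v \<circ> w = id" "w \<circ> v = id"
    using weyl_inverse_exists[OF g(1)] by blast
  have vw: "v (w x) = x" "w (v x) = x" for x using v(2,3) by (metis comp_apply id_apply)+
  have t': "- v t \<in> int_vec" using int_vec_diff[OF int_vec_zero int_vec_weyl[OF v(1) g(2)]] by simp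
  let ?h = "\<lambda>x. v x + of_nat M *\<^sub>R (- v t)"
  have "(?h \<circ> g) x = x" "(g \<circ> ?h) x = x" for x
    using linear_add[OF weyl_linear[OF v(1)]] linear_scale[OF weyl_linear[OF v(1)]]
      linear_diff[OF weyl_linear[OF g(1)]] linear_scale[OF weyl_linear[OF g(1)]]
    by (simp_all add: g(3) vw)
  then have "?h \<circ> g = id" "g \<circ> ?h = id" by (auto simp only: fun_eq_iff id_apply)
  with affine_weyl_groupI[OF v(1) t'] show ?thesis by blast
qed

lemma affine_id: "id \<in> affine_weyl_group l \<alpha> M" "affine_sign l \<alpha> id = 1"
proof -
  have eq: "id = (\<lambda>x::'a. id x + of_nat M *\<^sub>R 0)" by (simp add: fun_eq_iff)
  show "id \<in> affine_weyl_group l \<alpha> M"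
    by (subst eq) (intro affine_weyl_groupI id_weyl int_vec_zero)
  show "affine_sign l \<alpha> id = 1"
    by (subst eq) (simp only: affine_sign_eq[OF id_weyl] weyl_sign_id)
qed

lemma affine_int_vec: "g \<in> affine_weyl_group l \<alpha> M \<Longrightarrow> x \<in> int_vec \<Longrightarrow> g x \<in> int_vec"
  by (elim affine_weyl_groupE) (simp add: int_vec_add int_vec_scale int_vec_weyl)

lemma affine_alcove_id:
  assumes "g \<in> affine_weyl_group l \<alpha> M" "p \<in> alcove M" "g p \<in> alcove M"
  shows "g = id"
proof -
  obtain w t where g: "w \<in> weyl_group l \<alpha>" "t \<in> int_vec" "g = (\<lambda>x. w x + of_nat M *\<^sub>R t)"
    using affine_weyl_groupE[OF assms(1)] .
  show ?thesis using alcove_unique[OF g(1,2) assms(2)] assms(3) by (auto simp: g(3))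
qed

text \<open>With \<open>g'\<close> the inverse of \<open>g\<close>, the element
  \<open>h \<circ> g'\<close> moves the alcove point \<open>g x\<close> to the alcove point
  \<open>h x\<close>, hence is the identity.\<close>

lemma affine_alcove_unique:
  assumes "g \<in> affine_weyl_group l \<alpha> M" "h \<in> affine_weyl_group l \<alpha> M"
    "g x \<in> alcove M" "h x \<in> alcove M"
  shows "g = h"
proof -
  obtain g' where g': "g' \<in> affine_weyl_group l \<alpha> M" "g' \<circ> g = id" "g \<circ> g' = id"
    using affine_inverse[OF assms(1)] by blast
  have "g' (g x) = x" using g'(2) by (metis comp_apply id_apply)
  then have "h \<circ> g' = id"
    using affine_comp(1)[OF assms(2) g'(1)] assms(3,4) by (intro affine_alcove_id[of _ M "g x"]) auto
  then have "h \<circ> (g' \<circ> g) = g" by (metis comp_assoc id_comp)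
  then show ?thesis using g' by simp
qed

text \<open>The sign change of coordinate \<open>i\<close> is the conjugate by \<open>s_i\<close> of
  that of coordinate \<open>i + 1\<close>, starting from \<open>\<alpha> l = 2 e l\<close>. The case
  \<open>i = 1\<close> supplies the linear part of \<open>s_0\<close>.\<close>

lemma refl_double_weyl:
  assumes "1 \<le> i" "i \<le> l"
  shows "refl_root (2 *\<^sub>R e i) \<in> weyl_group l \<alpha>"
  using assms(2,1)
proof (induction rule: inc_induct)
  case base
  then show ?case using refl_weyl[of l] by (simp add: alpha_long)
next
  case (step i)
  have "refl_root (2 *\<^sub>R e i) = refl_root (\<alpha> i) \<circ> (refl_root (2 *\<^sub>R e (Suc i)) \<circ> refl_root (\<alpha> i))"
  proof
    fix x
    show "refl_root (2 *\<^sub>R e i) x = (refl_root (\<alpha> i) \<circ> (refl_root (2 *\<^sub>R e (Suc i)) \<circ> refl_root (\<alpha> i))) x"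
    proof (rule coord_eqI)
      fix j assume "j \<in> {1..l}"
      moreover from this have "Transposition.transpose i (Suc i) j \<in> {1..l}"
        using step by (auto simp: Transposition.transpose_def)
      ultimately show "refl_root (2 *\<^sub>R e i) x \<bullet> e j =
        (refl_root (\<alpha> i) \<circ> (refl_root (2 *\<^sub>R e (Suc i)) \<circ> refl_root (\<alpha> i))) x \<bullet> e j"
        using step by (auto simp: refl_double_coord refl_short_coord Transposition.transpose_def)
    qed
  qed
  then show ?case using step by (simp only:) (intro comp_weyl refl_weyl, auto)
qed

lemma weyl_sign_refl_double:
  assumes "i \<in> {1..l}"
  shows "weyl_sign l \<alpha> (refl_root (2 *\<^sub>R e i)) = - 1"
  using weyl_sign_eq[OF refl_double_weyl signed_perm_double, of i] assms
  by (simp add: perm_sign_def)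

section \<open>The generators and the elements \<open>w_i\<close> and \<open>w_I\<close>\<close>

lemma gen_s_zero: "gen_s l \<alpha> M 0 = (\<lambda>x. refl_root (2 *\<^sub>R e 1) x + of_nat M *\<^sub>R e 1)"
  by (simp add: gen_s_def nu_coroot_highest) (simp add: highest_root_eq)

lemma gen_s_affine:
  assumes "i \<le> l"
  shows "gen_s l \<alpha> M i \<in> affine_weyl_group l \<alpha> M" "affine_sign l \<alpha> (gen_s l \<alpha> M i) = - 1"
proof -
  have "\<exists>w\<in>weyl_group l \<alpha>. \<exists>t\<in>int_vec. weyl_sign l \<alpha> w = - 1 \<and> gen_s l \<alpha> M i = (\<lambda>x. w x + of_nat M *\<^sub>R t)"
  proof (cases "i = 0")
    case True
    then show ?thesis
      using refl_double_weyl[of 1] weyl_sign_refl_double[of 1] l_pos int_vec_e[of 1]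
      by (intro bexI[of _ "refl_root (2 *\<^sub>R e 1)"] bexI[of _ "e 1"])
        (auto simp: gen_s_zero)
  next
    case False
    then show ?thesis
      using refl_weyl[of i] weyl_sign_refl[of i] assms int_vec_zero
      by (intro bexI[of _ "refl_root (\<alpha> i)"] bexI[of _ "0"]) (auto simp: gen_s_def)
  qed
  then show "gen_s l \<alpha> M i \<in> affine_weyl_group l \<alpha> M" "affine_sign l \<alpha> (gen_s l \<alpha> M i) = - 1"
    using affine_weyl_groupI affine_sign_eq by auto
qed

lemma gen_s_zero_coord:
  "j \<in> {1..l} \<Longrightarrow> gen_s l \<alpha> M 0 x \<bullet> e j = (if j = 1 then of_nat M - x \<bullet> e 1 else x \<bullet> e j)"
  using refl_double_coord[of 1 j x] l_pos e_inner[of 1 j] by (auto simp: gen_s_zero inner_add_left)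

lemma gen_s_short_coord:
  "1 \<le> i \<Longrightarrow> i < l \<Longrightarrow> j \<in> {1..l} \<Longrightarrow>
    gen_s l \<alpha> M i x \<bullet> e j = x \<bullet> e (Transposition.transpose i (Suc i) j)"
  by (simp add: gen_s_def refl_short_coord)

lemma w_elt_affine:
  "i \<le> Suc l \<Longrightarrow> w_elt l \<alpha> M i \<in> affine_weyl_group l \<alpha> M \<and> affine_sign l \<alpha> (w_elt l \<alpha> M i) = (- 1) ^ i"
proof (induction i)
  case 0
  then show ?case by (simp only: w_elt.simps affine_id power_0 simp_thms)
next
  case (Suc i)
  then show ?case
    using affine_comp[OF gen_s_affine(1)[of i M], of "w_elt l \<alpha> M i"] gen_s_affine(2)[of i M]
    by (simp del: o_apply)
qed

lemma w_seq_Nil: "w_seq l \<alpha> M [] = id"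
  by (simp add: w_seq_def)

text \<open>The head of the list acts first, so it stands rightmost in the composition; the
  accumulator of the fold is generalized to extract it.\<close>

lemma w_seq_Cons: "w_seq l \<alpha> M (i # I) = w_seq l \<alpha> M I \<circ> w_elt l \<alpha> M i"
proof -
  have "fold (\<lambda>i f. w_elt l \<alpha> M i \<circ> f) I g = fold (\<lambda>i f. w_elt l \<alpha> M i \<circ> f) I id \<circ> g"
    for g :: "'a \<Rightarrow> 'a"
  proof (induction I arbitrary: g)
    case (Cons i I)
    show ?case
      using Cons[of "w_elt l \<alpha> M i \<circ> g"] Cons[of "w_elt l \<alpha> M i"] by (simp add: comp_assoc)
  qed simp
  from this[of "w_elt l \<alpha> M i"] show ?thesis by (simp add: w_seq_def)
qed

text \<open>Each \<open>w_i\<close> is a product of \<open>i\<close> generators of sign -1; this is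
  the source of the sign in the theorem.\<close>

lemma w_seq_affine:
  "\<forall>i\<in>set I. i \<le> l \<Longrightarrow>
    w_seq l \<alpha> M I \<in> affine_weyl_group l \<alpha> M \<and> affine_sign l \<alpha> (w_seq l \<alpha> M I) = (- 1) ^ sum_list I"
proof (induction I)
  case Nil
  then show ?case by (simp only: w_seq_Nil affine_id sum_list.Nil power_0 simp_thms)
next
  case (Cons i I)
  then show ?case
    using affine_comp[of "w_seq l \<alpha> M I" M "w_elt l \<alpha> M i"] w_elt_affine[of i M]
    by (simp add: w_seq_Cons power_add mult.commute del: o_apply)
qed

section \<open>Level weights as integral points of an alcove\<close>

lemma strictly_dominant_iff:
  "strictly_dominant l \<alpha> y \<longleftrightarrow> (\<forall>i\<in>{1..<l}. y \<bullet> e (Suc i) < y \<bullet> e i) \<and> 0 < y \<bullet> e l"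
proof -
  have "{1..l} = insert l {1..<l}" using l_pos by auto
  then show ?thesis
    unfolding strictly_dominant_def by (auto simp: nu_coroot_short nu_coroot_long inner_diff_right)
qed

lemma alcove_iff:
  "p \<in> alcove M \<longleftrightarrow> p \<in> int_vec \<and> strictly_dominant l \<alpha> p \<and> p \<bullet> highest_root l \<alpha> < of_nat M"
  unfolding alcove_def strictly_dominant_iff inner_highest by auto

text \<open>Since \<open>\<rho>\<close> pairs to 1 with every simple coroot, an integral pairing is
  nonnegative for \<open>x\<close> exactly when it is positive for \<open>x + \<rho>\<close>.
  Integrality passes to coordinates because the \<open>e i\<close> are sums of coroots.\<close>

lemma dominant_integral_iff:
  "x \<in> dominant_integral l \<alpha> \<longleftrightarrow> x + rho l \<alpha> \<in> int_vec \<and> strictly_dominant l \<alpha> (x + rho l \<alpha>)"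
proof
  assume x: "x \<in> dominant_integral l \<alpha>"
  then have n: "x \<bullet> nu_coroot (\<alpha> i) \<in> \<nat>" if "i \<in> {1..l}" for i
    using that by (simp add: dominant_integral_def)
  have "x \<bullet> e i \<in> \<int>" if "1 \<le> i" "i \<le> l" for i
    using that(2,1)
  proof (induction rule: inc_induct)
    case base
    then show ?case using n[of l] by (auto simp: nu_coroot_long Nats_altdef2)
  next
    case (step i)
    then have "x \<bullet> nu_coroot (\<alpha> i) + x \<bullet> e (Suc i) \<in> \<int>" using n[of i] by (auto simp: Nats_altdef2)
    then show ?case using step by (simp add: nu_coroot_short inner_diff_right)
  qed
  then have "x \<in> int_vec" by (auto simp: int_vec_def)
  moreover have "strictly_dominant l \<alpha> (x + rho l \<alpha>)"
    unfolding strictly_dominant_def using n by (auto simp: inner_add_left rho_coroot Nats_altdef2 add_nonneg_pos)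
  ultimately show "x + rho l \<alpha> \<in> int_vec \<and> strictly_dominant l \<alpha> (x + rho l \<alpha>)"
    using int_vec_add rho_int_vec by blast
next
  assume y: "x + rho l \<alpha> \<in> int_vec \<and> strictly_dominant l \<alpha> (x + rho l \<alpha>)"
  then have x: "x \<in> int_vec" using int_vec_diff[of "x + rho l \<alpha>", OF _ rho_int_vec] by simp
  show "x \<in> dominant_integral l \<alpha>"
    unfolding dominant_integral_def
  proof (intro CollectI ballI)
    fix i assume i: "i \<in> {1..l}"
    show "x \<bullet> nu_coroot (\<alpha> i) \<in> \<nat>"
      using y i int_vec_inner[OF x nu_coroot_int_vec[OF i]]
      by (intro Ints_gt_neg_one_Nats) (auto simp: strictly_dominant_def inner_add_left rho_coroot)
  qed
qed

text \<open>Between integers, \<open>(x, \<theta>) \<le> k\<close> means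
  \<open>(x, \<theta>) < k + 1\<close>; adding \<open>(\<rho>, \<theta>) = 2 l\<close> produces the
  dual Coxeter number on the right.\<close>

lemma level_weights_A2_iff:
  "x \<in> level_weights l \<alpha> form_A2 k \<longleftrightarrow> x + rho l \<alpha> \<in> alcove (k + dual_coxeter_A2 l)"
proof -
  have "x \<bullet> highest_root l \<alpha> \<le> of_nat k \<longleftrightarrow> (x + rho l \<alpha>) \<bullet> highest_root l \<alpha> < of_nat (k + dual_coxeter_A2 l)"
    if "x + rho l \<alpha> \<in> int_vec"
  proof -
    have "x \<bullet> e 1 \<in> \<int>"
      using int_vec_coord[of "x + rho l \<alpha> - rho l \<alpha>" 1, OF int_vec_diff[OF that rho_int_vec]] l_pos by simp
    then obtain a where "x \<bullet> e 1 = of_int a" by (auto elim: Ints_cases)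
    moreover have "rho l \<alpha> \<bullet> e 1 = real l" using rho_coord[of 1] l_pos by simp
    moreover have "real_of_int (2 * a) \<le> real_of_int (int k) \<longleftrightarrow> 2 * a \<le> int k"
      "real_of_int (2 * a) < real_of_int (int k + 1) \<longleftrightarrow> 2 * a < int k + 1"
      by (simp_all only: of_int_le_iff of_int_less_iff)
    ultimately show ?thesis
      by (auto simp: inner_highest inner_add_left dual_coxeter_A2_def)
  qed
  then show ?thesis
    unfolding level_weights_def alcove_iff form_A2_def using dominant_integral_iff by auto
qed

text \<open>With the halved form the bound reads \<open>x_1 \<le> k + l\<close> for an integer
  \<open>x_1\<close>, that is, \<open>x_1 + l < k + 2 l + 1\<close>; doubling gives the modulus
  \<open>2 N\<close>.\<close>

lemma level_weights_C1_iff: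
  "x \<in> level_weights l \<alpha> form_C1 (k + l) \<longleftrightarrow> x + rho l \<alpha> \<in> alcove (2 * (k + dual_coxeter_A2 l))"
proof -
  have "x \<bullet> highest_root l \<alpha> / 2 \<le> of_nat (k + l) \<longleftrightarrow>
      (x + rho l \<alpha>) \<bullet> highest_root l \<alpha> < of_nat (2 * (k + dual_coxeter_A2 l))"
    if "x + rho l \<alpha> \<in> int_vec"
  proof -
    have "x \<bullet> e 1 \<in> \<int>"
      using int_vec_coord[of "x + rho l \<alpha> - rho l \<alpha>" 1, OF int_vec_diff[OF that rho_int_vec]] l_pos by simp
    then obtain a where "x \<bullet> e 1 = of_int a" by (auto elim: Ints_cases)
    moreover have "rho l \<alpha> \<bullet> e 1 = real l" using rho_coord[of 1] l_pos by simp
    moreover have "real_of_int a \<le> real_of_int (int k + int l) \<longleftrightarrow> a \<le> int k + int l"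
      "real_of_int a < real_of_int (int k + int l + 1) \<longleftrightarrow> a < int k + int l + 1"
      by (simp_all only: of_int_le_iff of_int_less_iff)
    ultimately show ?thesis
      by (auto simp: inner_highest inner_add_left dual_coxeter_A2_def)
  qed
  then show ?thesis
    unfolding level_weights_def alcove_iff form_C1_def using dominant_integral_iff by auto
qed

lemma alcove_elt_iff:
  "x \<in> int_vec \<Longrightarrow> alcove_elt l \<alpha> M x g \<longleftrightarrow> g \<in> affine_weyl_group l \<alpha> M \<and> g x \<in> alcove M"
  unfolding alcove_elt_def alcove_iff form_A2_def by (auto intro: affine_int_vec)

end

section \<open>Moving points into the alcove\<close>

context C_roots
begin

lemma w_elt_coord:
  assumes "1 \<le> i" "i \<le> l" "j \<in> {1..l}"
  shows "w_elt l \<alpha> M i p \<bullet> e j =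
    (if j < i then p \<bullet> e (Suc j) else if j = i then of_nat M - p \<bullet> e 1 else p \<bullet> e j)"
  using assms
proof (induction i arbitrary: j rule: dec_induct)
  case base
  have "w_elt l \<alpha> M 1 = gen_s l \<alpha> M 0" by simp
  then show ?case using base gen_s_zero_coord[of j M p] by auto
next
  case (step i)
  have "Transposition.transpose i (Suc i) j \<in> {1..l}"
    using step by (auto simp: Transposition.transpose_def)
  then show ?case using step by (auto simp: gen_s_short_coord Transposition.transpose_def)
qed

lemma trivial_stabilizer_image:
  assumes "trivial_stabilizer (affine_weyl_group l \<alpha> M) x" "g \<in> affine_weyl_group l \<alpha> M"
  shows "trivial_stabilizer (affine_weyl_group l \<alpha> M) (g x)"
  unfolding trivial_stabilizer_def
proof (intro ballI impI)
  fix h assume h: "h \<in> affine_weyl_group l \<alpha> M" "h (g x) = g x"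
  obtain g' where g': "g' \<in> affine_weyl_group l \<alpha> M" "g' \<circ> g = id" "g \<circ> g' = id"
    using affine_inverse[OF assms(2)] by blast
  have "g' (g x) = x" using g'(2) by (metis comp_apply id_apply)
  then have "g' \<circ> (h \<circ> g) = id"
    using assms(1) affine_comp(1)[OF g'(1) affine_comp(1)[OF h(1) assms(2)]] h(2)
    by (auto simp: trivial_stabilizer_def)
  then have "g \<circ> (g' \<circ> (h \<circ> g)) \<circ> g' = g \<circ> id \<circ> g'" by simp
  moreover have "g \<circ> (g' \<circ> (h \<circ> g)) \<circ> g' = (g \<circ> g') \<circ> h \<circ> (g \<circ> g')" by (simp only: comp_assoc)
  ultimately show "h = id" using g'(3) by simp
qed

text \<open>A generator has sign -1, so it differs from the identity and cannot belong to a trivial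
  stabilizer.\<close>

lemma trivial_stabilizer_gen:
  assumes "trivial_stabilizer (affine_weyl_group l \<alpha> M) x" "i \<le> l"
  shows "gen_s l \<alpha> M i x \<noteq> x"
proof
  assume "gen_s l \<alpha> M i x = x"
  then have "gen_s l \<alpha> M i = id"
    using assms gen_s_affine(1)[of i M] by (simp add: trivial_stabilizer_def)
  then show False using gen_s_affine(2)[of i M] affine_id(2) assms by simp
qed

text \<open>The excluded equalities are the walls of \<open>s_0\<close> and \<open>s_i\<close>;
  without them no tie occurs when coordinates are compared with \<open>N / 2\<close> or with a
  neighbour.\<close>

lemma trivial_stabilizer_coord:
  assumes "trivial_stabilizer (affine_weyl_group l \<alpha> M) x"
  shows "2 * (x \<bullet> e 1) \<noteq> of_nat M" "1 \<le> i \<Longrightarrow> i < l \<Longrightarrow> x \<bullet> e i \<noteq> x \<bullet> e (Suc i)"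
proof -
  show "2 * (x \<bullet> e 1) \<noteq> of_nat M"
  proof
    assume *: "2 * (x \<bullet> e 1) = of_nat M"
    have "gen_s l \<alpha> M 0 x = x" by (rule coord_eqI) (use * in \<open>auto simp: gen_s_zero_coord\<close>)
    then show False using trivial_stabilizer_gen[OF assms, of 0] by simp
  qed
  assume i: "1 \<le> i" "i < l"
  show "x \<bullet> e i \<noteq> x \<bullet> e (Suc i)"
  proof
    assume *: "x \<bullet> e i = x \<bullet> e (Suc i)"
    have "gen_s l \<alpha> M i x = x"
      by (rule coord_eqI) (use * i in \<open>auto simp: gen_s_short_coord Transposition.transpose_def\<close>)
    then show False using trivial_stabilizer_gen[OF assms, of i] i by simp
  qed
qed

text \<open>
  If the first coordinate exceeds \<open>N / 2\<close>, then \<open>s_0\<close> replaces it by its mirror image and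
  \<open>s_1, s_2, \<dots>\<close> sort it into the remaining coordinates.
\<close>

lemma alcove_step:
  assumes p: "p \<in> alcove (2 * N)" and triv: "trivial_stabilizer (affine_weyl_group l \<alpha> N) p"
    and big: "of_nat N < 2 * (p \<bullet> e 1)"
  shows "\<exists>i\<in>{1..l}. w_elt l \<alpha> N i p \<in> alcove (2 * N)"
proof -
  \<comment> \<open>The place where the mirror image \<open>N - p_1\<close> belongs: everything to
    its right is smaller. It is \<open>l\<close> if no remaining coordinate is smaller.\<close>
  define i where "i = (LEAST i. 1 \<le> i \<and> (i = l \<or> p \<bullet> e (Suc i) < of_nat N - p \<bullet> e 1))"
  have i: "1 \<le> i \<and> (i = l \<or> p \<bullet> e (Suc i) < of_nat N - p \<bullet> e 1)"
    unfolding i_def by (rule LeastI[of _ l]) (use l_pos in auto)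
  have il: "i \<le> l" unfolding i_def by (rule Least_le) (use l_pos in auto)
  have less: "of_nat N - p \<bullet> e 1 \<le> p \<bullet> e (Suc j)" if "1 \<le> j" "j < i" for j
    using not_less_Least[OF that(2)[unfolded i_def]] that il by auto
  let ?q = "w_elt l \<alpha> N i p"
  have G: "?q \<in> int_vec" "trivial_stabilizer (affine_weyl_group l \<alpha> N) ?q"
    using w_elt_affine[of i N] il affine_int_vec alcove_int_vec[OF p] trivial_stabilizer_image[OF triv]
    by auto
  have q: "?q \<bullet> e j = (if j < i then p \<bullet> e (Suc j) else if j = i then of_nat N - p \<bullet> e 1 else p \<bullet> e j)"
    if "j \<in> {1..l}" for j
    using w_elt_coord that i il by auto
  note dec = alcove_decreasing[OF p] and bd = alcove_bounds[OF p]
  have "?q \<bullet> e (Suc j) < ?q \<bullet> e j" if j: "1 \<le> j" "j < l" for j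
  proof -
    consider "Suc j < i" | "Suc j = i" | "j = i" | "i < j" by linarith
    then show ?thesis
    proof cases
      \<comment> \<open>Here the new value \<open>N - p_1\<close> meets its left neighbour. The fact
        \<open>less\<close> permits a tie, which the trivial stabilizer of the image
        \<open>?q\<close> excludes.\<close>
      case 2
      then show ?thesis
        using trivial_stabilizer_coord(2)[OF G(2) j] q[of j] q[of "Suc j"] less[of j] j by auto
    qed (use q[of j] q[of "Suc j"] j i il dec[of "Suc j" "Suc (Suc j)"] dec[of j "Suc j"] in auto)
  qed
  \<comment> \<open>If \<open>i = l\<close>, the last coordinate is \<open>N - p_1\<close>, positive
    by the bound \<open>2 p_1 < 2 N\<close> of the large alcove.\<close>
  moreover have "0 < ?q \<bullet> e l" using q[of l] bd[of 1] bd[of l] l_pos il by auto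
  moreover have "2 * (?q \<bullet> e 1) < of_nat (2 * N)"
    using q[of 1] bd[of 1] bd[of 2] l_pos i il by (auto simp: numeral_2_eq_2)
  ultimately have "?q \<in> alcove (2 * N)" using G(1) by (auto simp: alcove_def)
  then show ?thesis using i il by auto
qed

text \<open>\<open>n\<close> bounds the number of coordinates above \<open>N / 2\<close>, and each
  step lowers the bound by one. Every list found is closed by an entry 0, with
  \<open>w_0 = id\<close>, so that it is nonempty; this accounts for \<open>Suc n\<close>.\<close>

lemma alcove_seq_exists:
  assumes "p \<in> alcove (2 * N)" "trivial_stabilizer (affine_weyl_group l \<alpha> N) p"
    "\<And>j. j \<in> {1..l} \<Longrightarrow> n < j \<Longrightarrow> 2 * (p \<bullet> e j) < of_nat N"
  shows "\<exists>I. (\<forall>i\<in>set I. i \<le> l) \<and> 1 \<le> length I \<and> length I \<le> Suc n \<and> w_seq l \<alpha> N I p \<in> alcove N"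
  using assms
proof (induction n arbitrary: p)
  case 0
  then have "p \<in> alcove N" using l_pos by (auto simp: alcove_def)
  then show ?case by (intro exI[of _ "[0]"]) (simp add: w_seq_Cons w_seq_Nil)
next
  case (Suc n)
  note p = Suc.prems
  consider "2 * (p \<bullet> e 1) < of_nat N" | "of_nat N < 2 * (p \<bullet> e 1)"
    using trivial_stabilizer_coord(1)[OF p(2)] by linarith
  then show ?case
  proof cases
    case 1
    then have "p \<in> alcove N" using p by (auto simp: alcove_def)
    then show ?thesis by (intro exI[of _ "[0]"]) (simp add: w_seq_Cons w_seq_Nil)
  next
    case 2
    then obtain i where i: "i \<in> {1..l}" "w_elt l \<alpha> N i p \<in> alcove (2 * N)" using alcove_step p by blast
    let ?q = "w_elt l \<alpha> N i p"
    \<comment> \<open>Before position \<open>i\<close> the coordinates are those of \<open>p\<close>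
      shifted by one place; from position \<open>i\<close> on, all are at most
      \<open>N - p_1 < N / 2\<close>.\<close>
    have "2 * (?q \<bullet> e j) < of_nat N" if j: "j \<in> {1..l}" "n < j" for j
    proof (cases "j < i")
      case True
      then show ?thesis using w_elt_coord[of i j] i j p(3)[of "Suc j"] by auto
    next
      case False
      then have "?q \<bullet> e j \<le> ?q \<bullet> e i"
        using alcove_decreasing[OF i(2), of i j] i(1) j by (cases "i = j") auto
      also have "?q \<bullet> e i = of_nat N - p \<bullet> e 1" using w_elt_coord[of i i] i by auto
      finally show ?thesis using 2 by simp
    qed
    moreover have "trivial_stabilizer (affine_weyl_group l \<alpha> N) ?q"
      by (rule trivial_stabilizer_image[OF p(2)]) (use w_elt_affine[of i N] i in simp)
    ultimately obtain I where "\<forall>i\<in>set I. i \<le> l" "1 \<le> length I" "length I \<le> Suc n"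
      "w_seq l \<alpha> N I ?q \<in> alcove N" using Suc.IH[OF i(2)] by blast
    then show ?thesis using i by (intro exI[of _ "i # I"]) (simp add: w_seq_Cons)
  qed
qed

text \<open>A point of the orbit of \<open>q\<close> closest to \<open>\<rho>\<close> lies in the closed alcove.\<close>

lemma alcove_or_odd_stabilizer:
  assumes q: "q \<in> int_vec" and M: "2 * l < M"
  shows "(\<exists>g\<in>affine_weyl_group l \<alpha> M. g q \<in> alcove M) \<or>
    (\<exists>g\<in>affine_weyl_group l \<alpha> M. affine_sign l \<alpha> g = - 1 \<and> g q = q)"
proof -
  let ?G = "affine_weyl_group l \<alpha> M"
  \<comment> \<open>On integral points the squared distance to \<open>\<rho>\<close> is a natural
    number, so the rounding loses nothing and a minimum over the orbit exists.\<close>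
  define f where "f g = nat \<lfloor>(g q - rho l \<alpha>) \<bullet> (g q - rho l \<alpha>)\<rfloor>" for g :: "'a \<Rightarrow> 'a"
  obtain g where g: "g \<in> ?G" "\<And>h. h \<in> ?G \<Longrightarrow> f g \<le> f h"
    using ex_has_least_nat[of "\<lambda>g. g \<in> ?G" id f] affine_id(1) by blast
  let ?y = "g q"
  have y: "?y \<in> int_vec" using affine_int_vec g(1) q by blast
  have f: "real (f h) = (h q - rho l \<alpha>) \<bullet> (h q - rho l \<alpha>)" if "h \<in> ?G" for h
  proof -
    have "h q - rho l \<alpha> \<in> int_vec" using int_vec_diff affine_int_vec[OF that q] rho_int_vec by blast
    then have "(h q - rho l \<alpha>) \<bullet> (h q - rho l \<alpha>) \<in> \<int>" by (intro int_vec_inner)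
    then obtain a where a: "(h q - rho l \<alpha>) \<bullet> (h q - rho l \<alpha>) = of_int a" by (auto elim: Ints_cases)
    then have "0 \<le> real_of_int a" by (metis inner_ge_zero)
    then show ?thesis by (simp add: f_def a)
  qed
  have le: "(?y - rho l \<alpha>) \<bullet> (?y - rho l \<alpha>) \<le> (h ?y - rho l \<alpha>) \<bullet> (h ?y - rho l \<alpha>)" if "h \<in> ?G" for h
  proof -
    have "h \<circ> g \<in> ?G" using affine_comp(1) that g(1) by blast
    then show ?thesis using g(2)[of "h \<circ> g"] f[of "h \<circ> g"] f[OF g(1)] by simp
  qed
  show ?thesis
  proof (cases "\<exists>i\<le>l. gen_s l \<alpha> M i ?y = ?y")
    case True
    then obtain i where i: "i \<le> l" "gen_s l \<alpha> M i ?y = ?y" by blast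
    \<comment> \<open>Conjugating the generator by \<open>g\<close> carries its fixed point
      \<open>?y\<close> back to \<open>q\<close> and keeps the sign -1.\<close>
    obtain g' where g': "g' \<in> ?G" "g' \<circ> g = id" "g \<circ> g' = id" using affine_inverse[OF g(1)] by blast
    have "affine_sign l \<alpha> (g' \<circ> (gen_s l \<alpha> M i \<circ> g)) = - (affine_sign l \<alpha> g' * affine_sign l \<alpha> g)"
      using affine_comp[OF gen_s_affine(1)[OF i(1)] g(1)] gen_s_affine(2)[OF i(1), of M]
        affine_comp(2)[OF g'(1), of "gen_s l \<alpha> M i \<circ> g"] by (simp del: o_apply)
    also have "\<dots> = - 1"
      using affine_comp(2)[OF g'(1) g(1)] g'(2) affine_id(2) by simp
    finally show ?thesis
      using affine_comp(1)[OF g'(1) affine_comp(1)[OF gen_s_affine(1)[OF i(1)] g(1)]] i(2) g'(2)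
      by (intro disjI2 bexI[of _ "g' \<circ> (gen_s l \<alpha> M i \<circ> g)"] conjI) (auto dest: fun_cong[of _ _ q])
  next
    case False
    have "0 < ?y \<bullet> nu_coroot (\<alpha> i)" if i: "i \<in> {1..l}" for i
    proof -
      let ?c = "?y \<bullet> nu_coroot (\<alpha> i)"
      have s: "gen_s l \<alpha> M i ?y = ?y - ?c *\<^sub>R \<alpha> i" using i by (simp add: gen_s_def refl_root_def)
      then have "?c \<noteq> 0" using False i by auto
      \<comment> \<open>Reflections preserve the norm, so minimality only compares pairings with
        \<open>\<rho>\<close> and yields \<open>0 \<le> ?c * (\<rho>, \<alpha> i)\<close>.\<close>
      have "0 < rho l \<alpha> \<bullet> \<alpha> i"
        using rho_coroot[OF i] alpha_norm_cases[OF i] by (auto simp: nu_coroot_def)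
      moreover have "gen_s l \<alpha> M i ?y \<bullet> gen_s l \<alpha> M i ?y = ?y \<bullet> ?y"
        using weyl_isometry[OF refl_weyl[OF i]] i by (simp add: gen_s_def)
      moreover have "gen_s l \<alpha> M i ?y \<bullet> rho l \<alpha> = ?y \<bullet> rho l \<alpha> - ?c * (rho l \<alpha> \<bullet> \<alpha> i)"
        by (simp add: s inner_diff_left inner_commute[of "\<alpha> i"])
      ultimately have "0 \<le> ?c * (rho l \<alpha> \<bullet> \<alpha> i)"
        using le[OF gen_s_affine(1), of i] i
        by (simp add: inner_diff_left inner_diff_right inner_commute mult.commute)
      then show ?thesis using \<open>?c \<noteq> 0\<close> \<open>0 < rho l \<alpha> \<bullet> \<alpha> i\<close> by (simp add: zero_le_mult_iff)
    qed
    moreover have "2 * (?y \<bullet> e 1) < of_nat M"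
    proof -
      let ?s = "gen_s l \<alpha> M 0 ?y" and ?r = "rho l \<alpha>"
      have ne: "2 * (?y \<bullet> e 1) \<noteq> of_nat M"
      proof
        assume *: "2 * (?y \<bullet> e 1) = of_nat M"
        have "?s = ?y" by (rule coord_eqI) (use * in \<open>auto simp: gen_s_zero_coord\<close>)
        then show False using False by blast
      qed
      have split: "x \<bullet> x = (x \<bullet> e 1)\<^sup>2 + (\<Sum>j\<in>{1..l} - {1}. (x \<bullet> e j)\<^sup>2)" for x
        unfolding inner_coord[of x x] using l_pos
        by (subst sum.remove[of _ 1]) (auto simp: power2_eq_square)
      have "(\<Sum>j\<in>{1..l} - {1}. ((?s - ?r) \<bullet> e j)\<^sup>2) = (\<Sum>j\<in>{1..l} - {1}. ((?y - ?r) \<bullet> e j)\<^sup>2)"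
        by (rule sum.cong) (auto simp: inner_diff_left gen_s_zero_coord)
      then have "((?y - ?r) \<bullet> e 1)\<^sup>2 \<le> ((?s - ?r) \<bullet> e 1)\<^sup>2"
        using le[OF gen_s_affine(1)[of 0]] split[of "?s - ?r"] split[of "?y - ?r"] by simp
      moreover have "?r \<bullet> e 1 = real l" using rho_coord[of 1] l_pos by simp
      ultimately have "(?y \<bullet> e 1 - real l)\<^sup>2 \<le> (of_nat M - ?y \<bullet> e 1 - real l)\<^sup>2"
        using l_pos by (simp add: inner_diff_left gen_s_zero_coord)
      \<comment> \<open>The difference of the two squares factors in this way; the first factor is
        positive because \<open>2 l < M\<close>, that is, because \<open>\<rho>\<close> itself lies
        in the alcove.\<close>
      then have "0 \<le> (real M - 2 * real l) * (real M - 2 * (?y \<bullet> e 1))"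
        by (simp add: power2_eq_square algebra_simps)
      moreover have "0 < real M - 2 * real l" using M by linarith
      ultimately show ?thesis using ne by (simp add: zero_le_mult_iff)
    qed
    ultimately have "?y \<in> alcove M"
      using y by (auto simp: alcove_iff strictly_dominant_def inner_highest)
    then show ?thesis using g(1) by blast
  qed
qed

end

section \<open>Orthogonality of the antisymmetric kernels\<close>

definition expi :: "nat \<Rightarrow> real \<Rightarrow> complex" where
  "expi M a = cis (- (2 * pi * a / of_nat M))"

lemma expi_add: "expi M (a + b) = expi M a * expi M b"
  by (simp add: expi_def cis_mult add_divide_distrib algebra_simps)

lemma expi_zero: "expi M 0 = 1"
  by (simp add: expi_def)

lemma expi_cnj: "cnj (expi M a) = expi M (- a)"
  by (simp add: expi_def cis_cnj)

lemma expi_sum: "expi M (\<Sum>i\<in>A. f i) = (\<Prod>i\<in>A. expi M (f i))"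
  by (induction A rule: infinite_finite_induct) (simp_all add: expi_zero expi_add)

lemma expi_power: "expi M a ^ n = expi M (a * of_nat n)"
  by (induction n) (simp_all add: expi_zero distrib_left expi_add)

lemma expi_eq_1_iff:
  assumes "0 < M"
  shows "expi M a = 1 \<longleftrightarrow> (\<exists>b::int. a = of_nat M * of_int b)"
proof
  assume "expi M a = 1"
  then have "cos (2 * pi * a / of_nat M) = 1" by (simp add: expi_def complex_eq_iff)
  then obtain b :: int where "2 * pi * a / of_nat M = of_int b * 2 * pi" using cos_one_2pi_int by blast
  then have "a = of_nat M * of_int b" using assms by (simp add: field_simps)
  then show "\<exists>b::int. a = of_nat M * of_int b" by blast
next
  assume "\<exists>b::int. a = of_nat M * of_int b"
  then obtain b :: int where "a = of_nat M * of_int b" by blast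
  then have "expi M a = cis (2 * pi * of_int (- b))" using assms by (simp add: expi_def mult.assoc)
  then show "expi M a = 1" by (simp only: cis_multiple_2pi Ints_of_int)
qed

lemma expi_geometric:
  assumes "0 < M" "a \<in> \<int>"
  shows "(\<Sum>n<M. expi M (a * of_nat n)) = (if \<exists>b::int. a = of_nat M * of_int b then of_nat M else 0)"
proof (cases "expi M a = 1")
  case True
  then show ?thesis using expi_eq_1_iff[OF assms(1), of a] by (simp flip: expi_power)
next
  case False
  have "expi M a ^ M = 1"
    using assms(2) unfolding expi_power expi_eq_1_iff[OF assms(1)] by (metis Ints_cases mult.commute)
  then have "(\<Sum>n<M. expi M a ^ n) = 0"
    using False by (simp add: geometric_sum)
  then show ?thesis using False expi_eq_1_iff[OF assms(1), of a] by (simp add: expi_power)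
qed

context C_roots
begin

definition kern :: "nat \<Rightarrow> 'a \<Rightarrow> 'a \<Rightarrow> complex" where
  "kern M p q = (\<Sum>w\<in>weyl_group l \<alpha>. of_int (weyl_sign l \<alpha> w) * expi M (p \<bullet> w q))"

abbreviation winv :: "('a \<Rightarrow> 'a) \<Rightarrow> 'a \<Rightarrow> 'a" where
  "winv w \<equiv> inv_into UNIV w"

lemma weyl_inv:
  assumes "w \<in> weyl_group l \<alpha>"
  shows "winv w \<in> weyl_group l \<alpha>" "winv w \<circ> w = id" "w \<circ> winv w = id" "winv (winv w) = w"
    "weyl_sign l \<alpha> (winv w) = weyl_sign l \<alpha> w"
proof -
  obtain v where v: "v \<in> weyl_group l \<alpha>" "v \<circ> w = id" "w \<circ> v = id" using weyl_inverse_exists[OF assms] by blast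
  have "winv w = v" "winv v = w" using inv_unique_comp v by blast+
  then show "winv w \<in> weyl_group l \<alpha>" "winv w \<circ> w = id" "w \<circ> winv w = id" "winv (winv w) = w"
    using v by simp_all
  have "weyl_sign l \<alpha> v * weyl_sign l \<alpha> w = 1"
    using weyl_sign_comp[OF v(1) assms] v(2) weyl_sign_id by simp
  then have "weyl_sign l \<alpha> v * (weyl_sign l \<alpha> w * weyl_sign l \<alpha> w) = weyl_sign l \<alpha> w"
    by (simp flip: mult.assoc)
  then show "weyl_sign l \<alpha> (winv w) = weyl_sign l \<alpha> w"
    using \<open>winv w = v\<close> by (simp add: weyl_sign_square)
qed

text \<open>Isometries move to the other argument as their inverses, which have the same sign; the
  sum is then reindexed by inversion.\<close>

lemma kern_sym: "kern M p q = kern M q p"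
  unfolding kern_def
proof (rule sum.reindex_bij_witness[of _ winv winv])
  fix w assume w: "w \<in> weyl_group l \<alpha>"
  show "of_int (weyl_sign l \<alpha> (winv w)) * expi M (q \<bullet> winv w p) = of_int (weyl_sign l \<alpha> w) * expi M (p \<bullet> w q)"
    using weyl_adjoint[OF w weyl_inv(2,3)[OF w], of p q] weyl_inv(5)[OF w] by (simp add: inner_commute)
qed (simp_all add: weyl_inv)

text \<open>A translation by \<open>M t\<close> multiplies each exponential by 1, because
  \<open>t\<close> and \<open>v q\<close> are integral. The linear part \<open>w\<close> is absorbed
  by substituting \<open>v = w \<circ> u\<close>, which costs its sign.\<close>

lemma kern_affine:
  assumes g: "g \<in> affine_weyl_group l \<alpha> M" and q: "q \<in> int_vec" and M: "0 < M"
  shows "kern M (g p) q = of_int (affine_sign l \<alpha> g) * kern M p q"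
proof -
  obtain w t where w: "w \<in> weyl_group l \<alpha>" and t: "t \<in> int_vec" and g: "g = (\<lambda>x. w x + of_nat M *\<^sub>R t)"
    "affine_sign l \<alpha> g = weyl_sign l \<alpha> w"
    using affine_weyl_groupE[OF g] .
  have 1: "expi M (g p \<bullet> v q) = expi M (w p \<bullet> v q)" if v: "v \<in> weyl_group l \<alpha>" for v
  proof -
    obtain b :: int where "t \<bullet> v q = of_int b" using int_vec_inner[OF t int_vec_weyl[OF v q]] by (auto elim: Ints_cases)
    then have "expi M (of_nat M * (t \<bullet> v q)) = 1" using expi_eq_1_iff[OF M] by auto
    then show ?thesis by (simp add: g(1) inner_add_left expi_add)
  qed
  have "kern M (g p) q = (\<Sum>v\<in>weyl_group l \<alpha>. of_int (weyl_sign l \<alpha> v) * expi M (w p \<bullet> v q))"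
    unfolding kern_def by (intro sum.cong) (simp_all add: 1)
  also have "\<dots> = (\<Sum>u\<in>weyl_group l \<alpha>. of_int (weyl_sign l \<alpha> w) * (of_int (weyl_sign l \<alpha> u) * expi M (p \<bullet> u q)))"
  proof (rule sum.reindex_bij_witness[of _ "\<lambda>u. w \<circ> u" "\<lambda>v. winv w \<circ> v"])
    fix v assume v: "v \<in> weyl_group l \<alpha>"
    show "w \<circ> (winv w \<circ> v) = v" "winv w \<circ> (w \<circ> v) = v"
      using weyl_inv(2,3)[OF w] by (metis comp_assoc id_comp)+
    show "winv w \<circ> v \<in> weyl_group l \<alpha>" "w \<circ> v \<in> weyl_group l \<alpha>"
      using comp_weyl weyl_inv(1)[OF w] v w by blast+
    have "weyl_sign l \<alpha> w * weyl_sign l \<alpha> (winv w \<circ> v) = weyl_sign l \<alpha> v"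
      using weyl_sign_comp[OF weyl_inv(1)[OF w] v] weyl_inv(5)[OF w] weyl_sign_square[of w]
      by (simp flip: mult.assoc del: o_apply)
    moreover have "w p \<bullet> v q = p \<bullet> winv w (v q)"
      using weyl_isometry[OF weyl_inv(1)[OF w], of "w p" "v q"] weyl_inv(2)[OF w] by (metis comp_apply id_apply)
    ultimately show "of_int (weyl_sign l \<alpha> w) * (of_int (weyl_sign l \<alpha> (winv w \<circ> v)) * expi M (p \<bullet> (winv w \<circ> v) q)) =
      of_int (weyl_sign l \<alpha> v) * expi M (w p \<bullet> v q)"
      by (simp flip: mult.assoc of_int_mult)
  qed
  finally show ?thesis unfolding g(2) by (simp only: kern_def sum_distrib_left)
qed

lemma affine_sign_square:
  assumes "g \<in> affine_weyl_group l \<alpha> M"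
  shows "affine_sign l \<alpha> g * affine_sign l \<alpha> g = 1"
  using affine_weyl_groupE[OF assms] weyl_sign_square by metis

text \<open>By \<open>kern_affine\<close>, the kernel at such a fixed point equals its own
  negative.\<close>

lemma kern_odd_stabilizer:
  assumes "g \<in> affine_weyl_group l \<alpha> M" "affine_sign l \<alpha> g = - 1" "g p = p" "q \<in> int_vec" "0 < M"
  shows "kern M p q = 0"
  using kern_affine[OF assms(1,4,5), of p] assms(2,3) by simp

section \<open>Fourier orthogonality on the grid (Z/M)^l\<close>

definition grid :: "nat \<Rightarrow> (nat \<Rightarrow> nat) set" where
  "grid M = PiE {1..l} (\<lambda>_. {..<M})"

definition vec :: "(nat \<Rightarrow> nat) \<Rightarrow> 'a" where
  "vec f = (\<Sum>i\<in>{1..l}. of_nat (f i) *\<^sub>R e i)"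

definition reduce :: "nat \<Rightarrow> 'a \<Rightarrow> nat \<Rightarrow> nat" where
  "reduce M x = (\<lambda>i\<in>{1..l}. nat (\<lfloor>x \<bullet> e i\<rfloor> mod int M))"

lemma finite_grid: "finite (grid M)"
  unfolding grid_def by (intro finite_PiE) auto

lemma vec_coord: "i \<in> {1..l} \<Longrightarrow> vec f \<bullet> e i = of_nat (f i)"
  unfolding vec_def by (rule coord_sum)

lemma vec_int_vec: "vec f \<in> int_vec"
  by (simp add: int_vec_def vec_coord del: One_nat_def)

lemma reduce_grid: "0 < M \<Longrightarrow> reduce M x \<in> grid M"
  unfolding reduce_def grid_def by (auto simp: nat_less_iff)

lemma vec_reduce:
  assumes "x \<in> int_vec" "0 < M"
  shows "\<exists>t\<in>int_vec. vec (reduce M x) = x + of_nat M *\<^sub>R t"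
proof -
  define t where "t = (\<Sum>i\<in>{1..l}. of_int (- (\<lfloor>x \<bullet> e i\<rfloor> div int M)) *\<^sub>R e i)"
  have tc: "t \<bullet> e i = of_int (- (\<lfloor>x \<bullet> e i\<rfloor> div int M))" if "i \<in> {1..l}" for i
    unfolding t_def by (rule coord_sum[OF that])
  have "vec (reduce M x) = x + of_nat M *\<^sub>R t"
  proof (rule coord_eqI)
    fix i assume i: "i \<in> {1..l}"
    obtain a where a: "x \<bullet> e i = of_int a" using int_vec_coord[OF assms(1) i] by (auto elim: Ints_cases)
    have "int (nat (a mod int M)) = a + int M * (- (a div int M))"
      using assms(2) by (simp add: minus_mult_div_eq_mod)
    then have "real (nat (a mod int M)) = real_of_int (a + int M * (- (a div int M)))"
      by (metis of_int_of_nat_eq)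
    then show "vec (reduce M x) \<bullet> e i = (x + of_nat M *\<^sub>R t) \<bullet> e i"
      using i by (simp add: vec_coord reduce_def inner_add_left tc a del: One_nat_def)
  qed
  moreover have "t \<in> int_vec" using tc by (simp add: int_vec_def)
  ultimately show ?thesis by blast
qed

lemma reduce_eqI:
  assumes "f \<in> grid M" "t \<in> int_vec" "vec f = x + of_nat M *\<^sub>R t"
  shows "reduce M x = f"
proof
  fix i
  show "reduce M x i = f i"
  proof (cases "i \<in> {1..l}")
    case True
    obtain b where b: "t \<bullet> e i = of_int b" using int_vec_coord[OF assms(2) True] by (auto elim: Ints_cases)
    have "x = vec f - of_nat M *\<^sub>R t" using assms(3) by simp
    then have "x \<bullet> e i = of_int (int (f i) - int M * b)"
      using True by (simp add: inner_diff_left vec_coord b)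
    then have "\<lfloor>x \<bullet> e i\<rfloor> = int (f i) - int M * b" by (simp only: floor_of_int)
    moreover have "f i < M" using assms(1) True by (auto simp: grid_def)
    moreover have "(int (f i) - int M * b) mod int M = int (f i) mod int M"
      using mod_mult_self2[of "int (f i)" "int M" "- b"] by simp
    ultimately show ?thesis using True by (simp add: reduce_def)
  next
    case False
    then show ?thesis using assms(1) by (auto simp: reduce_def grid_def PiE_def extensional_def)
  qed
qed

text \<open>Alcove points with the same residues modulo \<open>M\<close> differ by a translation of
  the affine group and hence coincide, so reduction embeds the alcove into the grid.\<close>

lemma finite_alcove: "finite (alcove M)"
proof (cases "M = 0")
  case True
  have "alcove M = {}" using alcove_bounds[of _ M l] l_pos True by fastforce
  then show ?thesis by simp
next
  case False
  have "inj_on (reduce M) (alcove M)"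
  proof
    fix p r assume pr: "p \<in> alcove M" "r \<in> alcove M" "reduce M p = reduce M r"
    obtain s t where st: "s \<in> int_vec" "vec (reduce M p) = p + of_nat M *\<^sub>R s"
      "t \<in> int_vec" "vec (reduce M r) = r + of_nat M *\<^sub>R t"
      using vec_reduce alcove_int_vec pr False by (metis gr0I)
    then have eq: "id p + of_nat M *\<^sub>R (s - t) = r" using pr(3) by (simp add: algebra_simps)
    then have "s - t = 0" using alcove_unique(2)[OF id_weyl int_vec_diff[OF st(1,3)] pr(1)] pr(2) by simp
    then show "p = r" using eq by simp
  qed
  moreover have "reduce M ` alcove M \<subseteq> grid M" using reduce_grid False by auto
  ultimately show ?thesis using finite_grid finite_subset finite_imageD by metis
qed

text \<open>The sum factors into one geometric sum for each coordinate, and such a sum vanishes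
  unless \<open>M\<close> divides that coordinate of \<open>v\<close>.\<close>

lemma grid_sum_expi:
  assumes "v \<in> int_vec" "0 < M"
  shows "(\<Sum>f\<in>grid M. expi M (vec f \<bullet> v)) =
    (if \<exists>t\<in>int_vec. v = of_nat M *\<^sub>R t then of_nat M ^ l else 0)"
proof -
  have "vec f \<bullet> v = (\<Sum>i\<in>{1..l}. (v \<bullet> e i) * of_nat (f i))" for f
    unfolding vec_def inner_sum_left by (intro sum.cong refl) (simp add: inner_commute mult.commute)
  then have "(\<Sum>f\<in>grid M. expi M (vec f \<bullet> v)) = (\<Sum>f\<in>grid M. \<Prod>i\<in>{1..l}. expi M ((v \<bullet> e i) * of_nat (f i)))"
    by (simp only: expi_sum)
  also have "\<dots> = (\<Prod>i\<in>{1..l}. \<Sum>n<M. expi M ((v \<bullet> e i) * of_nat n))"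
    unfolding grid_def by (rule prod_sum_PiE[symmetric]) auto
  also have "\<dots> = (\<Prod>i\<in>{1..l}. if \<exists>b::int. v \<bullet> e i = of_nat M * of_int b then of_nat M else 0)"
    using assms by (intro prod.cong) (simp_all add: expi_geometric int_vec_coord)
  also have "\<dots> = (if \<exists>t\<in>int_vec. v = of_nat M *\<^sub>R t then of_nat M ^ l else 0)"
  proof (cases "\<forall>i\<in>{1..l}. \<exists>b::int. v \<bullet> e i = of_nat M * of_int b")
    case True
    then obtain b :: "nat \<Rightarrow> int" where b: "\<And>i. i \<in> {1..l} \<Longrightarrow> v \<bullet> e i = of_nat M * of_int (b i)" by metis
    let ?t = "\<Sum>i\<in>{1..l}. of_int (b i) *\<^sub>R e i"
    have "?t \<in> int_vec" by (intro int_vec_sum int_vec_scale int_vec_e) auto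
    moreover have "v = of_nat M *\<^sub>R ?t"
      by (rule coord_eqI) (simp only: inner_scaleR_left coord_sum b)
    ultimately have "\<exists>t\<in>int_vec. v = of_nat M *\<^sub>R t" by blast
    then show ?thesis using True by simp
  next
    case False
    then obtain i where i: "i \<in> {1..l}" "\<nexists>b::int. v \<bullet> e i = of_nat M * of_int b" by blast
    then have "\<not> (\<exists>t\<in>int_vec. v = of_nat M *\<^sub>R t)"
      using int_vec_coord[OF _ i(1)] by (metis Ints_cases inner_scaleR_left)
    moreover have "(\<Prod>i\<in>{1..l}. if \<exists>b::int. v \<bullet> e i = of_nat M * of_int b then of_nat M else 0 :: complex) = 0"
      using i by (intro prod_zero) auto
    ultimately show ?thesis by simp
  qed
  finally show ?thesis .
qed

text \<open>Applying the inverse of \<open>w\<close> reduces the congruence to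
  \<open>alcove_unique\<close> for \<open>winv w \<circ> v\<close>. Hence the finite Weyl group
  images of alcove points are pairwise distinct modulo \<open>M\<close>.\<close>

lemma weyl_alcove_cong:
  assumes "v \<in> weyl_group l \<alpha>" "w \<in> weyl_group l \<alpha>" "p \<in> alcove M" "r \<in> alcove M" "t \<in> int_vec"
    and eq: "v p = w r + of_nat M *\<^sub>R t"
  shows "v = w" "p = r"
proof -
  have w: "winv w (w x) = x" "w (winv w x) = x" for x using weyl_inv(2,3)[OF assms(2)] by (metis comp_apply id_apply)+
  note lin = weyl_linear[OF weyl_inv(1)[OF assms(2)]]
  have "winv w (v p) = r + of_nat M *\<^sub>R winv w t"
    unfolding eq by (simp add: linear_add[OF lin] linear_scale[OF lin] w)
  then have r: "(winv w \<circ> v) p + of_nat M *\<^sub>R (- winv w t) = r" by simp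
  have t: "- winv w t \<in> int_vec"
    using int_vec_diff[OF int_vec_zero int_vec_weyl[OF weyl_inv(1)[OF assms(2)] assms(5)]] by simp
  note u = alcove_unique[OF comp_weyl[OF weyl_inv(1)[OF assms(2)] assms(1)] t assms(3), unfolded r, OF assms(4)]
  have "w (winv w (v x)) = w x" for x using u(1) by (metis comp_apply id_apply)
  then show "v = w" by (auto simp: w)
  show "p = r" using r u by simp
qed

lemma grid_sum_kern:
  assumes p: "p \<in> alcove M" and r: "r \<in> alcove M"
  shows "(\<Sum>f\<in>grid M. kern M p (vec f) * cnj (kern M r (vec f))) =
    (if p = r then of_nat (card (weyl_group l \<alpha>)) * of_nat M ^ l else 0)"
proof -
  let ?W = "weyl_group l \<alpha>"
  have M: "0 < M" using alcove_bounds[OF p, of l] l_pos by (cases M) auto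
  have "kern M p (vec f) * cnj (kern M r (vec f)) =
    (\<Sum>v\<in>?W. \<Sum>w\<in>?W. of_int (weyl_sign l \<alpha> v * weyl_sign l \<alpha> w) * expi M (vec f \<bullet> (v p - w r)))" for f
    \<comment> \<open>Symmetry puts \<open>vec f\<close> into the argument on which the Weyl group
      does not act, so the exponents combine to \<open>vec f \<bullet> (v p - w r)\<close>.\<close>
    unfolding kern_sym[of M p] kern_sym[of M r] unfolding kern_def cnj_sum sum_product
    by (intro sum.cong refl) (simp add: expi_cnj inner_diff_right expi_add[of M _ "- _", simplified])
  then have "(\<Sum>f\<in>grid M. kern M p (vec f) * cnj (kern M r (vec f))) =
    (\<Sum>f\<in>grid M. \<Sum>v\<in>?W. \<Sum>w\<in>?W. of_int (weyl_sign l \<alpha> v * weyl_sign l \<alpha> w) * expi M (vec f \<bullet> (v p - w r)))"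
    by simp
  also have "\<dots> = (\<Sum>v\<in>?W. \<Sum>w\<in>?W. \<Sum>f\<in>grid M. of_int (weyl_sign l \<alpha> v * weyl_sign l \<alpha> w) * expi M (vec f \<bullet> (v p - w r)))"
    by (subst sum.swap) (intro sum.cong refl sum.swap)
  also have "\<dots> = (\<Sum>v\<in>?W. \<Sum>w\<in>?W. if v = w \<and> p = r then of_nat M ^ l else 0)"
  proof (intro sum.cong refl)
    fix v w assume vw: "v \<in> ?W" "w \<in> ?W"
    have iv: "v p - w r \<in> int_vec" using int_vec_diff int_vec_weyl alcove_int_vec vw p r by blast
    have "(\<exists>t\<in>int_vec. v p - w r = of_nat M *\<^sub>R t) \<longleftrightarrow> v = w \<and> p = r"
    proof
      assume "\<exists>t\<in>int_vec. v p - w r = of_nat M *\<^sub>R t"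
      then obtain t where t: "t \<in> int_vec" "v p = w r + of_nat M *\<^sub>R t" by (metis add.commute diff_add_cancel)
      show "v = w \<and> p = r" using weyl_alcove_cong[OF vw p r t] by blast
    next
      assume "v = w \<and> p = r"
      then show "\<exists>t\<in>int_vec. v p - w r = of_nat M *\<^sub>R t" using int_vec_zero by (intro bexI[of _ 0]) auto
    qed
    then show "(\<Sum>f\<in>grid M. of_int (weyl_sign l \<alpha> v * weyl_sign l \<alpha> w) * expi M (vec f \<bullet> (v p - w r))) =
      (if v = w \<and> p = r then of_nat M ^ l else 0)"
      using grid_sum_expi[OF iv M] weyl_sign_square[of w]
      by (auto simp flip: sum_distrib_left of_int_mult)
  qed
  also have "\<dots> = (if p = r then of_nat (card ?W) * of_nat M ^ l else 0)"
    by (cases "p = r") (simp_all add: finite_weyl)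
  finally show ?thesis .
qed

text \<open>
  Up to the odd-stabilizer points, where the kernel vanishes, the grid consists of the reductions
  of the points \<open>w q\<close> with \<open>w\<close> in the finite Weyl group and \<open>q\<close> in the alcove.
\<close>

lemma alcove_orthogonality:
  assumes M: "2 * l < M" and p: "p \<in> alcove M" and r: "r \<in> alcove M"
  shows "(\<Sum>q\<in>alcove M. kern M p q * cnj (kern M r q)) = (if p = r then of_nat M ^ l else 0)"
proof -
  let ?W = "weyl_group l \<alpha>"
  let ?G = "affine_weyl_group l \<alpha> M"
  let ?g = "\<lambda>q. kern M p q * cnj (kern M r q)"
  let ?\<phi> = "\<lambda>(w, q). reduce M (w q)"
  have M0: "0 < M" using M by simp
  \<comment> \<open>Both factors change by the same sign, whose square is 1.\<close>
  have inv: "?g (h q) = ?g q" if h: "h \<in> ?G" for h q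
  proof -
    have "of_int (affine_sign l \<alpha> h) * of_int (affine_sign l \<alpha> h) = (1 :: complex)"
      using affine_sign_square[OF h] by (metis of_int_1 of_int_mult)
    then show ?thesis
      using kern_affine[OF h alcove_int_vec[OF p] M0, of q] kern_affine[OF h alcove_int_vec[OF r] M0, of q]
      by (simp add: kern_sym[of M p] kern_sym[of M r])
  qed
  have red: "\<exists>t\<in>int_vec. vec (reduce M (w q)) = w q + of_nat M *\<^sub>R t" if "w \<in> ?W" "q \<in> alcove M" for w q
    using vec_reduce[OF int_vec_weyl M0] that alcove_int_vec by blast
  have inj: "inj_on ?\<phi> (?W \<times> alcove M)"
  proof (rule inj_onI, clarify)
    fix v a w b
    assume v: "v \<in> ?W" "a \<in> alcove M" and w: "w \<in> ?W" "b \<in> alcove M"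
      and eq: "reduce M (v a) = reduce M (w b)"
    obtain s t where st: "s \<in> int_vec" "vec (reduce M (v a)) = v a + of_nat M *\<^sub>R s"
      "t \<in> int_vec" "vec (reduce M (w b)) = w b + of_nat M *\<^sub>R t" using red[OF v] red[OF w] by blast
    have "v a = w b + of_nat M *\<^sub>R (t - s)" using st eq by (simp add: algebra_simps)
    then show "v = w \<and> a = b" using weyl_alcove_cong[OF v(1) w(1) v(2) w(2) int_vec_diff[OF st(3,1)]] by blast
  qed
  have sub: "?\<phi> ` (?W \<times> alcove M) \<subseteq> grid M" using reduce_grid[OF M0] by auto
  have zero: "?g (vec f) = 0" if f: "f \<in> grid M - ?\<phi> ` (?W \<times> alcove M)" for f
    using alcove_or_odd_stabilizer[OF vec_int_vec[of f] M]
  proof (elim disjE bexE conjE)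
    fix g assume g: "g \<in> ?G" "g (vec f) \<in> alcove M"
    obtain h where h: "h \<in> ?G" "h \<circ> g = id" using affine_inverse[OF g(1)] by blast
    obtain w t where wt: "w \<in> ?W" "t \<in> int_vec" "h = (\<lambda>x. w x + of_nat M *\<^sub>R t)"
      using affine_weyl_groupE[OF h(1)] .
    have "vec f = h (g (vec f))" using h(2) by (metis comp_apply id_apply)
    then have "vec f = w (g (vec f)) + of_nat M *\<^sub>R t" by (simp add: wt(3))
    then have "f = ?\<phi> (w, g (vec f))" using reduce_eqI[OF _ wt(2)] f by auto
    then have "f \<in> ?\<phi> ` (?W \<times> alcove M)" using wt(1) g(2) by blast
    then show ?thesis using f by blast
  next
    fix g assume g: "g \<in> ?G" "affine_sign l \<alpha> g = - 1" "g (vec f) = vec f"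
    then have "kern M (vec f) p = 0" by (rule kern_odd_stabilizer[OF _ _ _ alcove_int_vec[OF p] M0])
    then show ?thesis by (simp add: kern_sym[of M p])
  qed
  have "(\<Sum>f\<in>grid M. ?g (vec f)) = (\<Sum>f\<in>?\<phi> ` (?W \<times> alcove M). ?g (vec f))"
    by (rule sum.mono_neutral_right[OF finite_grid sub]) (use zero in blast)
  also have "\<dots> = (\<Sum>x\<in>?W \<times> alcove M. ?g (vec (?\<phi> x)))"
    by (simp add: sum.reindex[OF inj])
  also have "\<dots> = (\<Sum>x\<in>?W \<times> alcove M. ?g (snd x))"
  proof (intro sum.cong refl)
    fix x assume "x \<in> ?W \<times> alcove M"
    then obtain w q where x: "x = (w, q)" "w \<in> ?W" "q \<in> alcove M" by blast
    then obtain t where t: "t \<in> int_vec" "vec (reduce M (w q)) = w q + of_nat M *\<^sub>R t" using red by blast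
    have "?g (vec (reduce M (w q))) = ?g q"
      using inv[OF affine_weyl_groupI[OF x(2) t(1)], of q] unfolding t(2) .
    then show "?g (vec (?\<phi> x)) = ?g (snd x)" by (simp add: x(1))
  qed
  \<comment> \<open>Each alcove point is counted once for every finite Weyl group element; the same
    factor occurs in \<open>grid_sum_kern\<close> and cancels.\<close>
  also have "\<dots> = of_nat (card ?W) * (\<Sum>q\<in>alcove M. ?g q)"
    by (simp add: sum.cartesian_product' sum_distrib_left)
  finally have "of_nat (card ?W) * (\<Sum>q\<in>alcove M. ?g q) =
      (if p = r then of_nat (card ?W) * of_nat M ^ l else 0)"
    unfolding grid_sum_kern[OF p r] by (rule sym)
  moreover have "card ?W \<noteq> 0" using finite_weyl id_weyl by auto
  ultimately show ?thesis by (cases "p = r") simp_all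
qed

end

section \<open>Verlinde algebras\<close>

lemma sum_fun_apply: "(\<Sum>i\<in>I. f i) x = (\<Sum>i\<in>I. f i x)" for f :: "'b \<Rightarrow> 'c \<Rightarrow> complex"
  by (induction I rule: infinite_finite_induct) simp_all

text \<open>The computation \<open>U = T S U = T\<close> fixes the entries on \<open>P\<close>, and
  the clause setting all other entries to 0 makes the definite description unique.\<close>

lemma inverse_matrix_on_unique:
  assumes P: "finite P"
    and S: "\<And>x y. x \<in> P \<Longrightarrow> y \<in> P \<Longrightarrow> (\<Sum>z\<in>P. S x z * T z y) = (if x = y then 1 else 0)"
    and T: "\<And>x y. x \<in> P \<Longrightarrow> y \<in> P \<Longrightarrow> (\<Sum>z\<in>P. T x z * S z y) = (if x = y then 1 else 0)"
    and xy: "x \<in> P" "y \<in> P"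
  shows "inverse_matrix_on P S x y = T x y"
proof -
  let ?T = "\<lambda>x y. if x \<in> P \<and> y \<in> P then T x y else 0"
  let ?Q = "\<lambda>T. (\<forall>x\<in>P. \<forall>y\<in>P. (\<Sum>z\<in>P. S x z * T z y) = (if x = y then 1 else 0)) \<and>
     (\<forall>x\<in>P. \<forall>y\<in>P. (\<Sum>z\<in>P. T x z * S z y) = (if x = y then 1 else 0)) \<and>
     (\<forall>x y. x \<notin> P \<or> y \<notin> P \<longrightarrow> T x y = 0)"
  have "inverse_matrix_on P S = ?T"
    unfolding inverse_matrix_on_def
  proof (rule the_equality)
    have "(\<Sum>z\<in>P. S x z * ?T z y) = (\<Sum>z\<in>P. S x z * T z y)" if "y \<in> P" for x y
      using that by (intro sum.cong) auto
    moreover have "(\<Sum>z\<in>P. ?T x z * S z y) = (\<Sum>z\<in>P. T x z * S z y)" if "x \<in> P" for x y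
      using that by (intro sum.cong) auto
    ultimately show "?Q ?T" using S T by auto
    fix U assume U: "?Q U"
    show "U = ?T"
    proof (intro ext)
      fix x y
      show "U x y = ?T x y"
      proof (cases "x \<in> P \<and> y \<in> P")
        case True
        then have x: "x \<in> P" and y: "y \<in> P" by auto
        have "U x y = (\<Sum>z\<in>P. (if x = z then 1 else 0) * U z y)"
          using P x by (simp add: if_distrib[of "\<lambda>c. c * _"] sum.delta' cong: if_cong)
        also have "\<dots> = (\<Sum>z\<in>P. (\<Sum>u\<in>P. T x u * S u z) * U z y)"
          using T x by (intro sum.cong) auto
        also have "\<dots> = (\<Sum>u\<in>P. T x u * (\<Sum>z\<in>P. S u z * U z y))"
          unfolding sum_distrib_left sum_distrib_right
          by (subst sum.swap) (simp add: mult.assoc)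
        also have "\<dots> = (\<Sum>u\<in>P. T x u * (if u = y then 1 else 0))"
          using U y by (intro sum.cong) auto
        also have "\<dots> = T x y"
          using P y by (simp add: if_distrib[of "\<lambda>c. _ * c"] sum.delta cong: if_cong)
        finally show ?thesis using True by simp
      qed (use U in auto)
    qed
  qed
  then show ?thesis using xy by simp
qed

text \<open>
  Division by \<open>S 0 \<phi>\<close> is harmless here even without knowing that \<open>S 0 \<phi> \<noteq> 0\<close>: the junk value of
  the quotient is the same on both sides.
\<close>

lemma verlinde_mult_eval:
  fixes l h m :: nat and \<alpha> :: "nat \<Rightarrow> 'a::real_inner" and form :: "'a \<Rightarrow> 'a \<Rightarrow> real"
  defines "P \<equiv> level_weights l \<alpha> form m"
  defines "S \<equiv> S_matrix l \<alpha> form h m"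
  assumes P: "finite P"
    and sym: "\<And>x y. x \<in> P \<Longrightarrow> y \<in> P \<Longrightarrow> S x y = S y x"
    and ST: "\<And>x y. x \<in> P \<Longrightarrow> y \<in> P \<Longrightarrow> (\<Sum>z\<in>P. S x z * inverse_matrix_on P S z y) = (if x = y then 1 else 0)"
    and \<psi>: "\<psi> \<in> P"
  shows "(\<Sum>z\<in>P. (f \<otimes>\<^bsub>verlinde l \<alpha> form h m\<^esub> g) z * S z \<psi>) =
    (\<Sum>x\<in>P. f x * S x \<psi>) * (\<Sum>y\<in>P. g y * S y \<psi>) / S 0 \<psi>"
proof -
  let ?N = "fusion_coeff l \<alpha> form h m"
  have N: "(\<Sum>z\<in>P. ?N x y z * S z \<psi>) = S x \<psi> * S y \<psi> / S 0 \<psi>" for x y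
  proof -
    \<comment> \<open>Symmetry turns \<open>S z \<psi>\<close> into \<open>S \<psi> z\<close>, which
      meets the inverse matrix and collapses the sum over \<open>\<phi>\<close> to
      \<open>\<phi> = \<psi>\<close>.\<close>
    have "(\<Sum>z\<in>P. ?N x y z * S z \<psi>) =
      (\<Sum>z\<in>P. \<Sum>\<phi>\<in>P. S x \<phi> * S y \<phi> / S 0 \<phi> * (S \<psi> z * inverse_matrix_on P S z \<phi>))"
      unfolding fusion_coeff_def Let_def P_def[symmetric] S_def[symmetric] sum_distrib_right
      using sym \<psi> by (intro sum.cong refl) simp
    also have "\<dots> = (\<Sum>\<phi>\<in>P. S x \<phi> * S y \<phi> / S 0 \<phi> * (\<Sum>z\<in>P. S \<psi> z * inverse_matrix_on P S z \<phi>))"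
      unfolding sum_distrib_left by (rule sum.swap)
    also have "\<dots> = (\<Sum>\<phi>\<in>P. if \<psi> = \<phi> then S x \<phi> * S y \<phi> / S 0 \<phi> else 0)"
      using ST \<psi> by (intro sum.cong) auto
    also have "\<dots> = S x \<psi> * S y \<psi> / S 0 \<psi>" using P \<psi> by simp
    finally show ?thesis .
  qed
  have "(f \<otimes>\<^bsub>verlinde l \<alpha> form h m\<^esub> g) z = (\<Sum>x\<in>P. \<Sum>y\<in>P. f x * g y * ?N x y z)" if "z \<in> P" for z
    using P that
    by (simp add: verlinde_def P_def[symmetric] sum_fun_apply cscale_def chi_def
        if_distrib[of "\<lambda>c. _ * c"] sum.delta cong: if_cong)
  then have "(\<Sum>z\<in>P. (f \<otimes>\<^bsub>verlinde l \<alpha> form h m\<^esub> g) z * S z \<psi>) =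
      (\<Sum>z\<in>P. \<Sum>x\<in>P. \<Sum>y\<in>P. f x * g y * (?N x y z * S z \<psi>))"
    by (intro sum.cong) (simp_all add: sum_distrib_right mult.assoc)
  also have "\<dots> = (\<Sum>x\<in>P. \<Sum>z\<in>P. \<Sum>y\<in>P. f x * g y * (?N x y z * S z \<psi>))"
    by (rule sum.swap)
  also have "\<dots> = (\<Sum>x\<in>P. \<Sum>y\<in>P. f x * g y * (\<Sum>z\<in>P. ?N x y z * S z \<psi>))"
    unfolding sum_distrib_left by (intro sum.cong refl sum.swap)
  also have "\<dots> = (\<Sum>x\<in>P. \<Sum>y\<in>P. (f x * S x \<psi>) * (g y * S y \<psi>) / S 0 \<psi>)"
    unfolding N by (intro sum.cong refl) simp
  also have "\<dots> = (\<Sum>x\<in>P. f x * S x \<psi>) * (\<Sum>y\<in>P. g y * S y \<psi>) / S 0 \<psi>"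
    by (simp add: sum_product sum_divide_distrib)
  finally show ?thesis .
qed

context C_roots
begin

lemma expi_exp: "expi M a = exp (- (2 * of_real pi * \<i> * of_real a) / of_nat M)"
  by (simp add: expi_def cis_conv_exp mult_ac)

lemma expi_double: "expi (2 * M) a = expi M (a / 2)"
  by (simp add: expi_def)

lemma S_matrix_A2: "S_matrix l \<alpha> form_A2 (dual_coxeter_A2 l) k x y =
    kern (k + dual_coxeter_A2 l) (x + rho l \<alpha>) (y + rho l \<alpha>)"
  unfolding S_matrix_def kern_def
  by (intro sum.cong refl) (simp only: expi_exp form_A2_def)

text \<open>Halving the form over the denominator \<open>N\<close> is the same as doubling the
  modulus.\<close>

lemma S_matrix_C1: "S_matrix l \<alpha> form_C1 (dual_coxeter_C1 l) (k + l) x y =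
    kern (2 * (k + dual_coxeter_A2 l)) (x + rho l \<alpha>) (y + rho l \<alpha>)"
proof -
  have N: "k + l + dual_coxeter_C1 l = k + dual_coxeter_A2 l"
    by (simp add: dual_coxeter_C1_def dual_coxeter_A2_def)
  show ?thesis
    unfolding S_matrix_def kern_def N
    by (intro sum.cong refl) (simp only: expi_double form_C1_def, simp only: expi_exp)
qed

definition weights :: "nat \<Rightarrow> 'a set" where
  "weights M = {x. x + rho l \<alpha> \<in> alcove M}"

definition skern :: "nat \<Rightarrow> 'a \<Rightarrow> 'a \<Rightarrow> complex" where
  "skern M x y = kern M (x + rho l \<alpha>) (y + rho l \<alpha>)"

lemma level_weights_A2: "level_weights l \<alpha> form_A2 k = weights (k + dual_coxeter_A2 l)"
  by (auto simp: weights_def level_weights_A2_iff)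

lemma level_weights_C1: "level_weights l \<alpha> form_C1 (k + l) = weights (2 * (k + dual_coxeter_A2 l))"
  by (auto simp: weights_def level_weights_C1_iff)

lemma alcove_image: "alcove M = (\<lambda>x. x + rho l \<alpha>) ` weights M"
proof -
  have "p \<in> (\<lambda>x. x + rho l \<alpha>) ` weights M" if "p \<in> alcove M" for p
    using that by (intro image_eqI[of _ _ "p - rho l \<alpha>"]) (simp_all add: weights_def)
  then show ?thesis by (auto simp: weights_def)
qed

lemma finite_weights: "finite (weights M)"
  using finite_alcove[of M] unfolding alcove_image by (rule finite_imageD) (simp add: inj_on_def)

lemma skern_sym: "skern M x y = skern M y x"
  unfolding skern_def by (rule kern_sym)

lemma skern_orthogonality:
  assumes "2 * l < M" "x \<in> weights M" "y \<in> weights M"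
  shows "(\<Sum>z\<in>weights M. skern M x z * cnj (skern M y z)) = (if x = y then of_nat M ^ l else 0)"
proof -
  have "inj_on (\<lambda>x. x + rho l \<alpha>) (weights M)" by (simp add: inj_on_def)
  then show ?thesis
    using alcove_orthogonality[OF assms(1), of "x + rho l \<alpha>" "y + rho l \<alpha>"] assms(2,3)
    unfolding skern_def by (simp add: alcove_image sum.reindex)
qed

text \<open>Orthogonality and symmetry show that the complex conjugate divided by \<open>M^l\<close>
  is a two-sided inverse, hence the matrix selected by \<open>inverse_matrix_on\<close>.\<close>

lemma skern_inverse:
  assumes M: "2 * l < M" and xy: "x \<in> weights M" "y \<in> weights M"
  shows "(\<Sum>z\<in>weights M. skern M x z * inverse_matrix_on (weights M) (skern M) z y) = (if x = y then 1 else 0)"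
proof -
  let ?P = "weights M" and ?S = "skern M"
  let ?T = "\<lambda>x y. cnj (?S x y) / of_nat M ^ l"
  have M0: "(of_nat M :: complex) \<noteq> 0" using M by simp
  have S: "(\<Sum>z\<in>?P. ?S x z * ?T z y) = (if x = y then 1 else 0)" if "x \<in> ?P" "y \<in> ?P" for x y
    using skern_orthogonality[OF M that] M0 by (simp add: skern_sym[of M _ y] flip: sum_divide_distrib)
  have T: "(\<Sum>z\<in>?P. ?T x z * ?S z y) = (if x = y then 1 else 0)" if "x \<in> ?P" "y \<in> ?P" for x y
  proof -
    have "?T x z * ?S z y = ?S y z * ?T z x" for z using skern_sym[of M y z] skern_sym[of M x z] by simp
    then have "(\<Sum>z\<in>?P. ?T x z * ?S z y) = (\<Sum>z\<in>?P. ?S y z * ?T z x)" by (simp only:)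
    then show ?thesis using S[OF that(2,1)] by simp
  qed
  have "(\<Sum>z\<in>?P. ?S x z * inverse_matrix_on ?P ?S z y) = (\<Sum>z\<in>?P. ?S x z * ?T z y)"
    using inverse_matrix_on_unique[of ?P ?S ?T, OF finite_weights S T] xy by (intro sum.cong refl) simp
  then show ?thesis using S[OF xy] by simp
qed

text \<open>The sums compared are the S-transforms of \<open>f\<close> and \<open>g\<close>; the
  inverse matrix recovers the coefficients. Identities in the Verlinde algebra can thus be checked
  one \<open>\<phi>\<close> at a time.\<close>

lemma skern_separates:
  assumes M: "2 * l < M" and f: "\<And>x. x \<notin> weights M \<Longrightarrow> f x = 0" and g: "\<And>x. x \<notin> weights M \<Longrightarrow> g x = 0"
    and eq: "\<And>\<phi>. \<phi> \<in> weights M \<Longrightarrow> (\<Sum>x\<in>weights M. f x * skern M x \<phi>) = (\<Sum>x\<in>weights M. g x * skern M x \<phi>)"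
  shows "f = g"
proof
  fix y
  let ?P = "weights M"
  let ?T = "inverse_matrix_on ?P (skern M)"
  have inv: "(\<Sum>\<phi>\<in>?P. (\<Sum>x\<in>?P. h x * skern M x \<phi>) * ?T \<phi> y) = h y" if "y \<in> ?P" for h
  proof -
    have "(\<Sum>\<phi>\<in>?P. (\<Sum>x\<in>?P. h x * skern M x \<phi>) * ?T \<phi> y) = (\<Sum>x\<in>?P. h x * (\<Sum>\<phi>\<in>?P. skern M x \<phi> * ?T \<phi> y))"
      unfolding sum_distrib_left sum_distrib_right by (subst sum.swap) (simp add: mult.assoc)
    also have "\<dots> = (\<Sum>x\<in>?P. if x = y then h x else 0)"
      using skern_inverse[OF M _ that] by (intro sum.cong) auto
    finally show ?thesis using that finite_weights by simp
  qed
  show "f y = g y"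
  proof (cases "y \<in> ?P")
    case True
    have "(\<Sum>\<phi>\<in>?P. (\<Sum>x\<in>?P. f x * skern M x \<phi>) * ?T \<phi> y) = (\<Sum>\<phi>\<in>?P. (\<Sum>x\<in>?P. g x * skern M x \<phi>) * ?T \<phi> y)"
      using eq by (intro sum.cong) auto
    then show ?thesis using inv[OF True] by metis
  qed (simp add: f g)
qed

text \<open>The choice by \<open>SOME\<close> is unique by \<open>affine_alcove_unique\<close>, so
  any known element moving the point into the alcove computes the value. In the theorem this element
  is \<open>w_I\<close>.\<close>

lemma Fk_value_cases:
  fixes k :: nat
  defines "N \<equiv> k + dual_coxeter_A2 l"
  assumes x: "x + rho l \<alpha> \<in> int_vec"
  shows "g \<in> affine_weyl_group l \<alpha> N \<Longrightarrow> g (x + rho l \<alpha>) \<in> alcove N \<Longrightarrow>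
      Fk_value l \<alpha> k x = cscale (of_int (affine_sign l \<alpha> g)) (chi (dot_action l \<alpha> g x))"
    and "(\<And>g. g \<in> affine_weyl_group l \<alpha> N \<Longrightarrow> g (x + rho l \<alpha>) \<notin> alcove N) \<Longrightarrow> Fk_value l \<alpha> k x = 0"
proof -
  note alc = alcove_elt_iff[OF x, of N]
  assume g: "g \<in> affine_weyl_group l \<alpha> N" "g (x + rho l \<alpha>) \<in> alcove N"
  have "(SOME w. alcove_elt l \<alpha> N (x + rho l \<alpha>) w) = g"
    using g affine_alcove_unique by (intro some_equality) (auto simp: alc)
  moreover have "\<exists>w. alcove_elt l \<alpha> N (x + rho l \<alpha>) w" using g alc by blast
  ultimately show "Fk_value l \<alpha> k x = cscale (of_int (affine_sign l \<alpha> g)) (chi (dot_action l \<alpha> g x))"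
    by (simp add: Fk_value_def Let_def flip: N_def)
next
  assume "\<And>g. g \<in> affine_weyl_group l \<alpha> N \<Longrightarrow> g (x + rho l \<alpha>) \<notin> alcove N"
  then show "Fk_value l \<alpha> k x = 0"
    using alcove_elt_iff[OF x, of N] unfolding Fk_value_def Let_def N_def by auto
qed

lemma Fk_value_weight:
  assumes "x \<in> weights (k + dual_coxeter_A2 l)"
  shows "Fk_value l \<alpha> k x = chi x"
proof -
  have a: "x + rho l \<alpha> \<in> alcove (k + dual_coxeter_A2 l)" using assms by (simp add: weights_def)
  show ?thesis
    using Fk_value_cases(1)[OF alcove_int_vec[OF a] affine_id(1)] a affine_id(2)
    by (simp add: dot_action_def cscale_def)
qed

lemma Fk_value_support:
  assumes "x + rho l \<alpha> \<in> int_vec" "z \<notin> weights (k + dual_coxeter_A2 l)"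
  shows "Fk_value l \<alpha> k x z = 0"
proof (cases "\<exists>g\<in>affine_weyl_group l \<alpha> (k + dual_coxeter_A2 l). g (x + rho l \<alpha>) \<in> alcove (k + dual_coxeter_A2 l)")
  case True
  then obtain g where g: "g \<in> affine_weyl_group l \<alpha> (k + dual_coxeter_A2 l)"
    "g (x + rho l \<alpha>) \<in> alcove (k + dual_coxeter_A2 l)" by blast
  then have "z \<noteq> dot_action l \<alpha> g x" using assms(2) by (auto simp: weights_def dot_action_def)
  then show ?thesis by (simp add: Fk_value_cases(1)[OF assms(1) g] cscale_def chi_def)
next
  case False
  then show ?thesis using Fk_value_cases(2)[OF assms(1), of k] by auto
qed

text \<open>If the orbit meets the alcove, the sign in \<open>F_k\<close> cancels the one from
  \<open>kern_affine\<close>; otherwise an odd stabilizer makes the kernel vanish together with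
  \<open>F_k\<close>.\<close>

lemma Fk_value_eval:
  fixes k :: nat
  defines "N \<equiv> k + dual_coxeter_A2 l"
  assumes x: "x + rho l \<alpha> \<in> int_vec" and \<phi>: "\<phi> \<in> weights N"
  shows "(\<Sum>z\<in>weights N. Fk_value l \<alpha> k x z * skern N z \<phi>) = skern N x \<phi>"
proof -
  have N: "2 * l < N" "0 < N" by (simp_all add: N_def dual_coxeter_A2_def)
  have p: "\<phi> + rho l \<alpha> \<in> int_vec" using \<phi> alcove_int_vec by (simp add: weights_def)
  show ?thesis
  proof (cases "\<exists>g\<in>affine_weyl_group l \<alpha> N. g (x + rho l \<alpha>) \<in> alcove N")
    case True
    then obtain g where g: "g \<in> affine_weyl_group l \<alpha> N" "g (x + rho l \<alpha>) \<in> alcove N" by blast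
    let ?\<mu> = "dot_action l \<alpha> g x"
    have \<mu>: "?\<mu> \<in> weights N" "?\<mu> + rho l \<alpha> = g (x + rho l \<alpha>)"
      using g(2) by (simp_all add: weights_def dot_action_def)
    have "(\<Sum>z\<in>weights N. Fk_value l \<alpha> k x z * skern N z \<phi>) =
        (\<Sum>z\<in>weights N. if z = ?\<mu> then of_int (affine_sign l \<alpha> g) * skern N ?\<mu> \<phi> else 0)"
      using Fk_value_cases(1)[OF x] g unfolding N_def by (intro sum.cong) (auto simp: cscale_def chi_def)
    also have "\<dots> = of_int (affine_sign l \<alpha> g) * skern N ?\<mu> \<phi>" using \<mu>(1) finite_weights by simp
    also have "\<dots> = of_int (affine_sign l \<alpha> g * affine_sign l \<alpha> g) * skern N x \<phi>"
      unfolding skern_def \<mu>(2) kern_affine[OF g(1) p N(2)] by simp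
    finally show ?thesis using affine_sign_square[OF g(1)] by simp
  next
    case False
    then obtain g where g: "g \<in> affine_weyl_group l \<alpha> N" "affine_sign l \<alpha> g = - 1"
      "g (x + rho l \<alpha>) = x + rho l \<alpha>" using alcove_or_odd_stabilizer[OF x N(1)] by blast
    have "skern N x \<phi> = 0" unfolding skern_def by (rule kern_odd_stabilizer[OF g p N(2)])
    moreover have "Fk_value l \<alpha> k x = 0" using Fk_value_cases(2)[OF x, of k] False unfolding N_def by blast
    ultimately show ?thesis by simp
  qed
qed

text \<open>The weight is chosen so that its shift by \<open>\<rho>\<close> is
  \<open>2 (\<phi> + \<rho>)\<close>: doubling the point compensates for doubling the
  modulus.\<close>

lemma double_weight:
  assumes "\<phi> \<in> weights N"
  shows "\<phi> + \<phi> + rho l \<alpha> \<in> weights (2 * N)" "skern (2 * N) x (\<phi> + \<phi> + rho l \<alpha>) = skern N x \<phi>"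
proof -
  let ?p = "\<phi> + rho l \<alpha>"
  have eq: "\<phi> + \<phi> + rho l \<alpha> + rho l \<alpha> = 2 *\<^sub>R ?p" by (simp add: scaleR_2)
  have p: "?p \<in> alcove N" using assms by (simp add: weights_def)
  then have "2 *\<^sub>R ?p \<in> alcove (2 * N)"
    using int_vec_scale[of ?p 2] by (auto simp: alcove_def)
  then show "\<phi> + \<phi> + rho l \<alpha> \<in> weights (2 * N)" by (simp add: weights_def eq)
  show "skern (2 * N) x (\<phi> + \<phi> + rho l \<alpha>) = skern N x \<phi>"
    unfolding skern_def kern_def eq
  proof (intro sum.cong refl)
    fix w assume "w \<in> weyl_group l \<alpha>"
    then have "w (2 *\<^sub>R ?p) = 2 *\<^sub>R w ?p" using linear_scale[OF weyl_linear] by blast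
    then show "of_int (weyl_sign l \<alpha> w) * expi (2 * N) ((x + rho l \<alpha>) \<bullet> w (2 *\<^sub>R ?p)) =
      of_int (weyl_sign l \<alpha> w) * expi N ((x + rho l \<alpha>) \<bullet> w ?p)"
      by (simp add: expi_double)
  qed
qed

end

section \<open>The homomorphism\<close>

lemma verlinde_simps:
  "carrier (verlinde l \<alpha> form h m) = {f. \<forall>x. x \<notin> level_weights l \<alpha> form m \<longrightarrow> f x = 0}"
  "\<one>\<^bsub>verlinde l \<alpha> form h m\<^esub> = chi 0"
  "f \<oplus>\<^bsub>verlinde l \<alpha> form h m\<^esub> g = f + g"
  "c \<odot>\<^bsub>verlinde l \<alpha> form h m\<^esub> f = cscale c f"
  by (simp_all add: verlinde_def Let_def)

lemma verlinde_mult_support: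
  "z \<notin> level_weights l \<alpha> form m \<Longrightarrow> (f \<otimes>\<^bsub>verlinde l \<alpha> form h m\<^esub> g) z = 0"
  by (simp add: verlinde_def Let_def sum_fun_apply cscale_def chi_def) (intro sum.neutral ballI, auto)

context C_roots
begin

text \<open>Built from \<open>Fk_value\<close> alone, so that one map serves every \<open>Fk\<close>
  satisfying \<open>is_Fk\<close>.\<close>

definition hom_F :: "nat \<Rightarrow> ('a \<Rightarrow> complex) \<Rightarrow> 'a \<Rightarrow> complex" where
  "hom_F k f = (\<Sum>x\<in>weights (2 * (k + dual_coxeter_A2 l)). cscale (f x) (Fk_value l \<alpha> k x))"

lemma hom_F_apply:
  "hom_F k f z = (\<Sum>x\<in>weights (2 * (k + dual_coxeter_A2 l)). f x * Fk_value l \<alpha> k x z)"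
  by (simp add: hom_F_def sum_fun_apply cscale_def)

lemma weights_int_vec: "x \<in> weights M \<Longrightarrow> x + rho l \<alpha> \<in> int_vec"
  by (simp add: weights_def alcove_int_vec)

lemma hom_F_support: "z \<notin> weights (k + dual_coxeter_A2 l) \<Longrightarrow> hom_F k f z = 0"
  unfolding hom_F_apply by (intro sum.neutral) (simp add: Fk_value_support weights_int_vec)

lemma hom_F_chi:
  assumes "x \<in> weights (2 * (k + dual_coxeter_A2 l))"
  shows "hom_F k (chi x) = Fk_value l \<alpha> k x"
proof
  fix z
  have "hom_F k (chi x) z =
      (\<Sum>y\<in>weights (2 * (k + dual_coxeter_A2 l)). if y = x then Fk_value l \<alpha> k x z else 0)"
    unfolding hom_F_apply by (intro sum.cong) (auto simp: chi_def)
  then show "hom_F k (chi x) z = Fk_value l \<alpha> k x z" using assms finite_weights by simp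
qed

text \<open>\<open>Fk_value_eval\<close> trades the value of \<open>F_k\<close> for the kernel of
  modulus \<open>N\<close>, \<open>double_weight\<close> passes to modulus \<open>2 N\<close>, and
  linearity does the rest.\<close>

lemma hom_F_eval:
  fixes k :: nat
  defines "N \<equiv> k + dual_coxeter_A2 l"
  assumes "\<phi> \<in> weights N"
  shows "(\<Sum>z\<in>weights N. hom_F k f z * skern N z \<phi>) =
    (\<Sum>x\<in>weights (2 * N). f x * skern (2 * N) x (\<phi> + \<phi> + rho l \<alpha>))"
proof -
  have "(\<Sum>z\<in>weights N. hom_F k f z * skern N z \<phi>) =
      (\<Sum>x\<in>weights (2 * N). f x * (\<Sum>z\<in>weights N. Fk_value l \<alpha> k x z * skern N z \<phi>))"
    unfolding hom_F_apply N_def[symmetric] sum_distrib_left sum_distrib_right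
    by (subst sum.swap) (simp add: mult.assoc)
  also have "\<dots> = (\<Sum>x\<in>weights (2 * N). f x * skern (2 * N) x (\<phi> + \<phi> + rho l \<alpha>))"
    using assms(2) Fk_value_eval[of _ \<phi> k] double_weight(2)[of \<phi> N] weights_int_vec
    unfolding N_def by (intro sum.cong refl) simp
  finally show ?thesis .
qed

lemma verlinde_A2_mult_eval:
  fixes k :: nat
  defines "N \<equiv> k + dual_coxeter_A2 l"
  assumes "\<phi> \<in> weights N"
  shows "(\<Sum>z\<in>weights N. (f \<otimes>\<^bsub>verlinde_A2 l \<alpha> k\<^esub> g) z * skern N z \<phi>) =
    (\<Sum>x\<in>weights N. f x * skern N x \<phi>) * (\<Sum>y\<in>weights N. g y * skern N y \<phi>) / skern N 0 \<phi>"
proof -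
  have P: "level_weights l \<alpha> form_A2 k = weights N" by (simp add: level_weights_A2 N_def)
  have S: "S_matrix l \<alpha> form_A2 (dual_coxeter_A2 l) k = skern N"
    by (intro ext) (simp add: S_matrix_A2 skern_def N_def)
  have M: "2 * l < N" by (simp add: N_def dual_coxeter_A2_def)
  show ?thesis
    unfolding verlinde_A2_def
    by (rule verlinde_mult_eval[where form = form_A2 and h = "dual_coxeter_A2 l" and m = k and l = l and \<alpha> = \<alpha>,
          unfolded P S, OF finite_weights skern_sym skern_inverse[OF M] assms(2)])
qed

lemma verlinde_C1_mult_eval:
  fixes k :: nat
  defines "N \<equiv> 2 * (k + dual_coxeter_A2 l)"
  assumes "\<phi> \<in> weights N"
  shows "(\<Sum>z\<in>weights N. (f \<otimes>\<^bsub>verlinde_C1 l \<alpha> (k + l)\<^esub> g) z * skern N z \<phi>) =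
    (\<Sum>x\<in>weights N. f x * skern N x \<phi>) * (\<Sum>y\<in>weights N. g y * skern N y \<phi>) / skern N 0 \<phi>"
proof -
  have P: "level_weights l \<alpha> form_C1 (k + l) = weights N" by (simp add: level_weights_C1 N_def)
  have S: "S_matrix l \<alpha> form_C1 (dual_coxeter_C1 l) (k + l) = skern N"
    by (intro ext) (simp add: S_matrix_C1 skern_def N_def)
  have M: "2 * l < N" by (simp add: N_def dual_coxeter_A2_def)
  show ?thesis
    unfolding verlinde_C1_def
    by (rule verlinde_mult_eval[where form = form_C1 and h = "dual_coxeter_C1 l" and m = "k + l" and l = l and \<alpha> = \<alpha>,
          unfolded P S, OF finite_weights skern_sym skern_inverse[OF M] assms(2)])
qed

lemma hom_F_mult:
  "hom_F k (f \<otimes>\<^bsub>verlinde_C1 l \<alpha> (k + l)\<^esub> g) = hom_F k f \<otimes>\<^bsub>verlinde_A2 l \<alpha> k\<^esub> hom_F k g"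
proof -
  let ?N = "k + dual_coxeter_A2 l"
  show ?thesis
  proof (rule skern_separates[of ?N])
    show "2 * l < ?N" by (simp add: dual_coxeter_A2_def)
    show "hom_F k (f \<otimes>\<^bsub>verlinde_C1 l \<alpha> (k + l)\<^esub> g) z = 0" if "z \<notin> weights ?N" for z
      using that by (rule hom_F_support)
    show "(hom_F k f \<otimes>\<^bsub>verlinde_A2 l \<alpha> k\<^esub> hom_F k g) z = 0" if "z \<notin> weights ?N" for z
      using that unfolding verlinde_A2_def by (intro verlinde_mult_support) (simp add: level_weights_A2)
    fix \<phi> assume \<phi>: "\<phi> \<in> weights ?N"
    note d = double_weight[OF \<phi>]
    show "(\<Sum>x\<in>weights ?N. hom_F k (f \<otimes>\<^bsub>verlinde_C1 l \<alpha> (k + l)\<^esub> g) x * skern ?N x \<phi>) =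
        (\<Sum>x\<in>weights ?N. (hom_F k f \<otimes>\<^bsub>verlinde_A2 l \<alpha> k\<^esub> hom_F k g) x * skern ?N x \<phi>)"
      \<comment> \<open>Both sides become the same product divided by a kernel at weight 0;
        \<open>d(2)\<close> at \<open>x = 0\<close> identifies the denominators as well.\<close>
      unfolding hom_F_eval[OF \<phi>] verlinde_A2_mult_eval[OF \<phi>] verlinde_C1_mult_eval[OF d(1)]
      by (simp only: d(2))
  qed
qed

lemma zero_dominant_integral: "0 \<in> dominant_integral l \<alpha>"
  by (simp add: dominant_integral_def)

lemma zero_weights: "0 \<in> weights (k + dual_coxeter_A2 l)" "0 \<in> weights (2 * (k + dual_coxeter_A2 l))"
  unfolding level_weights_A2[symmetric] level_weights_C1[symmetric]
  by (simp_all add: level_weights_def form_A2_def form_C1_def zero_dominant_integral)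

lemma hom_F_alg_hom: "hom_F k \<in> complex_alg_hom (verlinde_C1 l \<alpha> (k + l)) (verlinde_A2 l \<alpha> k)"
proof -
  have one: "hom_F k (chi 0) = chi 0"
    using hom_F_chi[OF zero_weights(2)] Fk_value_weight[OF zero_weights(1)] by simp
  have add: "hom_F k (f + g) = hom_F k f + hom_F k g" for f g
    by (intro ext) (simp add: hom_F_apply distrib_right sum.distrib)
  have scale: "hom_F k (cscale c f) = cscale c (hom_F k f)" for c f
    by (intro ext) (simp add: hom_F_apply cscale_def sum_distrib_left mult.assoc)
  have carrier: "hom_F k f \<in> carrier (verlinde_A2 l \<alpha> k)" for f
    by (simp add: verlinde_A2_def verlinde_simps level_weights_A2 hom_F_support)
  show ?thesis
    unfolding complex_alg_hom_def ring_hom_def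
    using carrier hom_F_mult one add scale
    by (simp add: verlinde_simps verlinde_A2_def verlinde_C1_def)
qed

lemma Fk_level_weight:
  assumes "is_Fk l \<alpha> k Fk" "x \<in> level_weights l \<alpha> form m"
  shows "Fk (irr_char l \<alpha> x) = Fk_value l \<alpha> k x"
  using assms by (simp add: is_Fk_def level_weights_def)

end

theorem theorem5p9:
  fixes l k :: nat and \<alpha> :: "nat \<Rightarrow> 'a::euclidean_space"
  assumes "type_C l \<alpha>" and "0 < k"
  shows
    "(\<forall>x\<in>level_weights l \<alpha> form_C1 (k + l).
        trivial_stabilizer (affine_weyl_group l \<alpha> (k + dual_coxeter_A2 l)) (x + rho l \<alpha>) \<longrightarrow>
        (\<exists>\<mu> I. alcove_seq l \<alpha> k x \<mu> I)) \<and>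
     (\<forall>Fk. is_Fk l \<alpha> k Fk \<longrightarrow>
        (\<exists>F\<in>complex_alg_hom (verlinde_C1 l \<alpha> (k + l)) (verlinde_A2 l \<alpha> k).
           (\<forall>x\<in>level_weights l \<alpha> form_C1 (k + l). F (chi x) = Fk (irr_char l \<alpha> x)) \<and>
           (\<forall>x\<in>level_weights l \<alpha> form_C1 (k + l).
              trivial_stabilizer (affine_weyl_group l \<alpha> (k + dual_coxeter_A2 l)) (x + rho l \<alpha>) \<longrightarrow>
              (\<forall>\<mu> I. alcove_seq l \<alpha> k x \<mu> I \<longrightarrow>
                 F (chi x) = cscale ((- 1) ^ sum_list I)
                   (Fk (irr_char l \<alpha>
                      (dot_action l \<alpha> (w_seq l \<alpha> (k + dual_coxeter_A2 l) I) x)))))))"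
proof -
  interpret C_roots l \<alpha> by unfold_locales (rule assms(1))
  let ?N = "k + dual_coxeter_A2 l"
  have "\<exists>\<mu> I. alcove_seq l \<alpha> k x \<mu> I"
    if x: "x \<in> level_weights l \<alpha> form_C1 (k + l)"
      and triv: "trivial_stabilizer (affine_weyl_group l \<alpha> ?N) (x + rho l \<alpha>)" for x
  proof -
    have p: "x + rho l \<alpha> \<in> alcove (2 * ?N)" using x by (simp add: level_weights_C1_iff)
    \<comment> \<open>Taking \<open>n = l\<close> makes the condition on later coordinates vacuous
      and bounds the length by \<open>l + 1\<close>, which is at most
      \<open>k + 2 l + 1\<close>.\<close>
    obtain I where I: "\<forall>i\<in>set I. i \<le> l" "1 \<le> length I" "length I \<le> Suc l"
      "w_seq l \<alpha> ?N I (x + rho l \<alpha>) \<in> alcove ?N"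
      using alcove_seq_exists[OF p triv, of l] by auto
    have "alcove_seq l \<alpha> k x (dot_action l \<alpha> (w_seq l \<alpha> ?N I) x) I"
      using I by (simp add: alcove_seq_def level_weights_A2_iff dot_action_def)
    then show ?thesis by blast
  qed
  moreover have "hom_F k (chi x) = Fk (irr_char l \<alpha> x)"
    if "is_Fk l \<alpha> k Fk" "x \<in> level_weights l \<alpha> form_C1 (k + l)" for Fk x
    using hom_F_chi[of x k] Fk_level_weight[OF that] that(2) by (simp add: level_weights_C1)
  moreover have "hom_F k (chi x) =
      cscale ((- 1) ^ sum_list I) (Fk (irr_char l \<alpha> (dot_action l \<alpha> (w_seq l \<alpha> ?N I) x)))"
    if Fk: "is_Fk l \<alpha> k Fk" and x: "x \<in> level_weights l \<alpha> form_C1 (k + l)"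
      and I: "alcove_seq l \<alpha> k x \<mu> I" for Fk x \<mu> I
  proof -
    let ?w = "w_seq l \<alpha> ?N I"
    have \<mu>: "\<mu> \<in> weights ?N" "\<mu> + rho l \<alpha> = ?w (x + rho l \<alpha>)" "\<forall>i\<in>set I. i \<le> l"
      using I by (simp_all add: alcove_seq_def level_weights_A2)
    have eq: "dot_action l \<alpha> ?w x = \<mu>" using \<mu>(2) by (simp add: dot_action_def flip: \<mu>(2))
    have xi: "x + rho l \<alpha> \<in> int_vec" using x weights_int_vec by (simp add: level_weights_C1)
    have "?w (x + rho l \<alpha>) \<in> alcove ?N" using \<mu>(1,2) by (simp add: weights_def)
    \<comment> \<open>\<open>w_I\<close> itself moves the point into the alcove, so its sign is the
      one in \<open>F_k\<close>; at \<open>\<mu>\<close>, already inside the alcove,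
      \<open>F_k\<close> gives \<open>chi \<mu>\<close> with sign 1.\<close>
    then have "Fk_value l \<alpha> k x = cscale ((- 1) ^ sum_list I) (chi \<mu>)"
      using Fk_value_cases(1)[OF xi, of ?w k] w_seq_affine[OF \<mu>(3), of ?N] eq by simp
    moreover have "Fk (irr_char l \<alpha> \<mu>) = chi \<mu>"
      using Fk_level_weight[OF Fk, of \<mu> form_A2 k] Fk_value_weight[OF \<mu>(1)] \<mu>(1) by (simp add: level_weights_A2)
    moreover have "hom_F k (chi x) = Fk_value l \<alpha> k x" using x hom_F_chi by (simp add: level_weights_C1)
    ultimately show ?thesis by (simp add: eq)
  qed
  ultimately show ?thesis using hom_F_alg_hom[of k] by blast
qed

end
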